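(* Let $R$ be a valuation ring with maximal ideal $P$, and let $Z$ be its set of zerodivisors (a prime ideal). Then: (1) For every $0\neq r\in P$, $R/Rr$ is an IF-ring. (2) For every prime ideal $J\subsetneq Z$, the localization $R_J$ is an IF-ring.
   Context: All rings are commutative with unity and modules are unital. A valuation ring is a ring whose ideals are linearly ordered by inclusion. A ring is an IF-ring if every injective module over it is flat. *)

theory Defs
  imports "HOL-Algebra.Free_Abelian_Groups" "HOL-Algebra.Generated_Groups"
    "HOL-Algebra.Module" "HOL-Algebra.QuotRing"
begin

section \<open>Valuation rings and zerodivisors\<close>

text \<open>The ring need not be a domain.\<close>

definition valuation_ring :: "('a, 'b) ring_scheme \<Rightarrow> bool"
  where "valuation_ring R \<longleftrightarrow>
    cring R \<and> (\<forall>I J. ideal I R \<longrightarrow> ideal J R \<longrightarrow> I \<subseteq> J \<or> J \<subseteq> I)"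

text \<open>In a nonzero ring, \<open>0\<close> is a zerodivisor.\<close>

definition zerodivisors :: "('a, 'b) ring_scheme \<Rightarrow> 'a set"
  where "zerodivisors R =
    {z \<in> carrier R. \<exists>x \<in> carrier R. x \<noteq> \<zero>\<^bsub>R\<^esub> \<and> z \<otimes>\<^bsub>R\<^esub> x = \<zero>\<^bsub>R\<^esub>}"


section \<open>Localization\<close>

definition fraction_rel :: "('a, 'b) ring_scheme \<Rightarrow> 'a set \<Rightarrow> (('a \<times> 'a) \<times> ('a \<times> 'a)) set"
  where "fraction_rel R S =
    {((a, s), (b, t)). a \<in> carrier R \<and> b \<in> carrier R \<and> s \<in> S \<and> t \<in> S \<and>
       (\<exists>u \<in> S. u \<otimes>\<^bsub>R\<^esub> (t \<otimes>\<^bsub>R\<^esub> a) = u \<otimes>\<^bsub>R\<^esub> (s \<otimes>\<^bsub>R\<^esub> b))}"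

definition fraction :: "('a, 'b) ring_scheme \<Rightarrow> 'a set \<Rightarrow> 'a \<Rightarrow> 'a \<Rightarrow> ('a \<times> 'a) set"
  where "fraction R S a s = fraction_rel R S `` {(a, s)}"

text \<open>As for \<^const>\<open>FactRing\<close>, the operations on classes are unions over all
  representatives; for a multiplicative set \<open>S\<close> the classes united all coincide.\<close>

definition localization :: "('a, 'b) ring_scheme \<Rightarrow> 'a set \<Rightarrow> ('a \<times> 'a) set ring"
  where "localization R S =
    \<lparr>carrier = (carrier R \<times> S) // fraction_rel R S,
     mult = (\<lambda>X Y. (\<Union>(a, s)\<in>X. (\<Union>(b, t)\<in>Y. fraction R S (a \<otimes>\<^bsub>R\<^esub> b) (s \<otimes>\<^bsub>R\<^esub> t)))),
     one = fraction R S \<one>\<^bsub>R\<^esub> \<one>\<^bsub>R\<^esub>,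
     zero = fraction R S \<zero>\<^bsub>R\<^esub> \<one>\<^bsub>R\<^esub>,
     add = (\<lambda>X Y. (\<Union>(a, s)\<in>X. (\<Union>(b, t)\<in>Y.
              fraction R S (t \<otimes>\<^bsub>R\<^esub> a \<oplus>\<^bsub>R\<^esub> s \<otimes>\<^bsub>R\<^esub> b) (s \<otimes>\<^bsub>R\<^esub> t))))\<rparr>"

definition localization_at_prime :: "('a, 'b) ring_scheme \<Rightarrow> 'a set \<Rightarrow> ('a \<times> 'a) set ring"
  where "localization_at_prime R J = localization R (carrier R - J)"


section \<open>Linear maps and injective modules\<close>

definition module_hom ::
    "('a, 'b) ring_scheme \<Rightarrow> ('a, 'm, 'c) module_scheme \<Rightarrow> ('a, 'n, 'd) module_scheme \<Rightarrow> ('m \<Rightarrow> 'n) set"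
  where "module_hom R M N =
    {f \<in> carrier M \<rightarrow> carrier N.
       (\<forall>x \<in> carrier M. \<forall>y \<in> carrier M. f (x \<oplus>\<^bsub>M\<^esub> y) = f x \<oplus>\<^bsub>N\<^esub> f y) \<and>
       (\<forall>r \<in> carrier R. \<forall>x \<in> carrier M. f (r \<odot>\<^bsub>M\<^esub> x) = r \<odot>\<^bsub>N\<^esub> f x)}"

text \<open>HOL cannot quantify over types inside a formula, so the type \<open>'t\<close> of the elements of
  the test modules \<open>A\<close> and \<open>B\<close> is a parameter. By Baer's criterion (lemma
  \<open>injective_module_universe\<close> below) the choice of the type of ring elements for \<open>'t\<close> already
  gives the extension property for test modules over every type.\<close>

definition injective_module ::
    "'t itself \<Rightarrow> ('a, 'b) ring_scheme \<Rightarrow> ('a, 'm, 'c) module_scheme \<Rightarrow> bool"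
  where "injective_module T R M \<longleftrightarrow>
    module R M \<and>
    (\<forall>(A :: ('a, 't) module) (B :: ('a, 't) module) f g.
       module R A \<longrightarrow> module R B \<longrightarrow>
       f \<in> module_hom R A B \<longrightarrow> inj_on f (carrier A) \<longrightarrow> g \<in> module_hom R A M \<longrightarrow>
       (\<exists>h \<in> module_hom R B M. \<forall>x \<in> carrier A. h (f x) = g x))"


section \<open>Tensor products and flat modules\<close>

definition tensor_relators ::
    "('a, 'b) ring_scheme \<Rightarrow> ('a, 'm, 'c) module_scheme \<Rightarrow> ('a, 'n, 'd) module_scheme
      \<Rightarrow> (('m \<times> 'n) \<Rightarrow>\<^sub>0 int) set"
  where "tensor_relators R M N =
    {frag_of (x \<oplus>\<^bsub>M\<^esub> x', y) - frag_of (x, y) - frag_of (x', y) | x x' y.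
       x \<in> carrier M \<and> x' \<in> carrier M \<and> y \<in> carrier N} \<union>
    {frag_of (x, y \<oplus>\<^bsub>N\<^esub> y') - frag_of (x, y) - frag_of (x, y') | x y y'.
       x \<in> carrier M \<and> y \<in> carrier N \<and> y' \<in> carrier N} \<union>
    {frag_of (r \<odot>\<^bsub>M\<^esub> x, y) - frag_of (x, r \<odot>\<^bsub>N\<^esub> y) | r x y.
       r \<in> carrier R \<and> x \<in> carrier M \<and> y \<in> carrier N}"

definition tensor_kernel ::
    "('a, 'b) ring_scheme \<Rightarrow> ('a, 'm, 'c) module_scheme \<Rightarrow> ('a, 'n, 'd) module_scheme
      \<Rightarrow> (('m \<times> 'n) \<Rightarrow>\<^sub>0 int) set"
  where "tensor_kernel R M N =
    generate (free_Abelian_group (carrier M \<times> carrier N)) (tensor_relators R M N)"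

text \<open>Only the underlying abelian group of the tensor product is recorded (multiplicatively,
  as for \<^const>\<open>free_Abelian_group\<close>): flatness is about injectivity of maps of tensor
  products, and the action of the ring plays no part in that.\<close>

definition tensor_product ::
    "('a, 'b) ring_scheme \<Rightarrow> ('a, 'm, 'c) module_scheme \<Rightarrow> ('a, 'n, 'd) module_scheme
      \<Rightarrow> (('m \<times> 'n) \<Rightarrow>\<^sub>0 int) set monoid"
  where "tensor_product R M N =
    free_Abelian_group (carrier M \<times> carrier N) Mod tensor_kernel R M N"

definition pure_tensor ::
    "('a, 'b) ring_scheme \<Rightarrow> ('a, 'm, 'c) module_scheme \<Rightarrow> ('a, 'n, 'd) module_scheme
      \<Rightarrow> 'm \<Rightarrow> 'n \<Rightarrow> (('m \<times> 'n) \<Rightarrow>\<^sub>0 int) set"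
  where "pure_tensor R M N x y =
    tensor_kernel R M N #>\<^bsub>free_Abelian_group (carrier M \<times> carrier N)\<^esub> frag_of (x, y)"

text \<open>The map \<open>f \<otimes> N\<close> from \<open>A \<otimes> N\<close> to \<open>B \<otimes> N\<close> induced by a linear map \<open>f\<close> from \<open>A\<close> to \<open>B\<close>;
  see lemmas \<open>tensor_map_hom\<close> and \<open>tensor_map_pure_tensor\<close>.\<close>

definition tensor_map ::
    "('a, 'b) ring_scheme \<Rightarrow> ('a, 'm, 'c) module_scheme \<Rightarrow> ('a, 'k, 'e) module_scheme
      \<Rightarrow> ('a, 'n, 'd) module_scheme \<Rightarrow> ('m \<Rightarrow> 'k)
      \<Rightarrow> (('m \<times> 'n) \<Rightarrow>\<^sub>0 int) set \<Rightarrow> (('k \<times> 'n) \<Rightarrow>\<^sub>0 int) set"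
  where "tensor_map R A B N f X =
    (\<Union>c \<in> X. tensor_kernel R B N #>\<^bsub>free_Abelian_group (carrier B \<times> carrier N)\<^esub>
               frag_extend (\<lambda>(x, y). frag_of (f x, y)) c)"

text \<open>\<open>'t\<close> is the type of the elements of the test modules. Flatness occurs only as a
  conclusion, where a free \<open>'t\<close> stands for every type.\<close>

definition flat_module ::
    "'t itself \<Rightarrow> ('a, 'b) ring_scheme \<Rightarrow> ('a, 'm, 'c) module_scheme \<Rightarrow> bool"
  where "flat_module T R M \<longleftrightarrow>
    module R M \<and>
    (\<forall>(A :: ('a, 't) module) (B :: ('a, 't) module) f.
       module R A \<longrightarrow> module R B \<longrightarrow>
       f \<in> module_hom R A B \<longrightarrow> inj_on f (carrier A) \<longrightarrow>
       inj_on (tensor_map R A B M f) (carrier (tensor_product R A M)))"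


section \<open>IF-rings\<close>

text \<open>Injective modules with elements of type \<open>'m\<close> are to be flat with respect to test modules
  with elements of type \<open>'t\<close>; a theorem in which \<open>'m\<close> and \<open>'t\<close> are free speaks about
  all modules. Injectivity, being a hypothesis, is tested on the type \<open>'a\<close> of ring elements,
  which amounts to injectivity with respect to all modules.\<close>

definition IF_ring :: "'m itself \<Rightarrow> 't itself \<Rightarrow> ('a, 'b) ring_scheme \<Rightarrow> bool"
  where "IF_ring M T R \<longleftrightarrow>
    cring R \<and>
    (\<forall>E :: ('a, 'm) module. injective_module TYPE('a) R E \<longrightarrow> flat_module T R E)"


section \<open>Adequacy of the definitions\<close>

lemma module_homI:
  assumes "\<And>x. x \<in> carrier M \<Longrightarrow> f x \<in> carrier N"
    "\<And>x y. x \<in> carrier M \<Longrightarrow> y \<in> carrier M \<Longrightarrow> f (x \<oplus>\<^bsub>M\<^esub> y) = f x \<oplus>\<^bsub>N\<^esub> f y"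
    "\<And>r x. r \<in> carrier R \<Longrightarrow> x \<in> carrier M \<Longrightarrow> f (r \<odot>\<^bsub>M\<^esub> x) = r \<odot>\<^bsub>N\<^esub> f x"
  shows "f \<in> module_hom R M N"
  using assms by (auto simp: module_hom_def)

lemma module_homD:
  assumes "f \<in> module_hom R M N"
  shows "x \<in> carrier M \<Longrightarrow> f x \<in> carrier N"
    "x \<in> carrier M \<Longrightarrow> y \<in> carrier M \<Longrightarrow> f (x \<oplus>\<^bsub>M\<^esub> y) = f x \<oplus>\<^bsub>N\<^esub> f y"
    "r \<in> carrier R \<Longrightarrow> x \<in> carrier M \<Longrightarrow> f (r \<odot>\<^bsub>M\<^esub> x) = r \<odot>\<^bsub>N\<^esub> f x"
  using assms by (auto simp: module_hom_def)

lemma module_hom_zero: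
  assumes "module R M" "module R N" "f \<in> module_hom R M N"
  shows "f \<zero>\<^bsub>M\<^esub> = \<zero>\<^bsub>N\<^esub>"
proof -
  interpret M: module R M by fact
  interpret N: module R N by fact
  have "f (\<zero>\<^bsub>R\<^esub> \<odot>\<^bsub>M\<^esub> \<zero>\<^bsub>M\<^esub>) = \<zero>\<^bsub>R\<^esub> \<odot>\<^bsub>N\<^esub> f \<zero>\<^bsub>M\<^esub>"
    using module_homD(3)[OF assms(3)] by blast
  then show ?thesis
    using module_homD(1)[OF assms(3)] by simp
qed

text \<open>An ideal of \<open>R\<close>, as a module over \<open>R\<close>.\<close>

definition ideal_module :: "('a, 'b) ring_scheme \<Rightarrow> 'a set \<Rightarrow> ('a, 'a) module"
  where "ideal_module R I =
    \<lparr>carrier = I, mult = mult R, one = \<one>\<^bsub>R\<^esub>, zero = \<zero>\<^bsub>R\<^esub>, add = add R, smult = mult R\<rparr>"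

lemma ideal_module:
  assumes "cring R" "ideal I R"
  shows "module R (ideal_module R I)"
proof -
  interpret cring R by fact
  interpret I: ideal I R by fact
  have sub: "I \<subseteq> carrier R" by (rule I.a_subset)
  have mem: "x \<in> carrier R" if "x \<in> I" for x using sub that by blast
  show ?thesis
  proof (rule moduleI)
    show "abelian_group (ideal_module R I)"
    proof (rule abelian_groupI)
      fix x assume "x \<in> carrier (ideal_module R I)"
      then show "\<exists>y\<in>carrier (ideal_module R I). y \<oplus>\<^bsub>ideal_module R I\<^esub> x = \<zero>\<^bsub>ideal_module R I\<^esub>"
        by (auto simp: ideal_module_def mem intro!: bexI[of _ "\<ominus>\<^bsub>R\<^esub> x"] l_neg)
    qed (auto simp: ideal_module_def mem a_assoc a_comm a_lcomm)
  qed (auto simp: ideal_module_def mem I.I_l_closed l_distr r_distr m_assoc is_cring)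
qed

theorem injective_module_universe:
  fixes R :: "('a, 'b) ring_scheme" and M :: "('a, 'm, 'c) module_scheme"
  assumes "injective_module TYPE('a) R M"
  shows "injective_module TYPE('t) R M"
proof -
  have M: "module R M" using assms by (simp add: injective_module_def)
  interpret M: module R M by fact
  show ?thesis
    unfolding injective_module_def
  proof (intro conjI allI impI, rule M)
    fix A B :: "('a, 't) module" and f g
    assume A: "module R A" and B: "module R B" and f: "f \<in> module_hom R A B"
      and inj: "inj_on f (carrier A)" and g: "g \<in> module_hom R A M"
    interpret A: module R A by fact
    interpret B: module R B by fact
    note f' = module_homD[OF f] and g' = module_homD[OF g]
    define partial where "partial G \<longleftrightarrow> G \<subseteq> carrier B \<times> carrier M \<and>
        (\<lambda>x. (f x, g x)) ` carrier A \<subseteq> G \<and>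
        (\<forall>x m y n. (x, m) \<in> G \<longrightarrow> (y, n) \<in> G \<longrightarrow> (x \<oplus>\<^bsub>B\<^esub> y, m \<oplus>\<^bsub>M\<^esub> n) \<in> G) \<and>
        (\<forall>r\<in>carrier R. \<forall>x m. (x, m) \<in> G \<longrightarrow> (r \<odot>\<^bsub>B\<^esub> x, r \<odot>\<^bsub>M\<^esub> m) \<in> G) \<and>
        (\<forall>m. (\<zero>\<^bsub>B\<^esub>, m) \<in> G \<longrightarrow> m = \<zero>\<^bsub>M\<^esub>)" for G
    have pI: "partial G" if "G \<subseteq> carrier B \<times> carrier M" "(\<lambda>x. (f x, g x)) ` carrier A \<subseteq> G"
        "\<And>x m y n. (x, m) \<in> G \<Longrightarrow> (y, n) \<in> G \<Longrightarrow> (x \<oplus>\<^bsub>B\<^esub> y, m \<oplus>\<^bsub>M\<^esub> n) \<in> G"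
        "\<And>r x m. r \<in> carrier R \<Longrightarrow> (x, m) \<in> G \<Longrightarrow> (r \<odot>\<^bsub>B\<^esub> x, r \<odot>\<^bsub>M\<^esub> m) \<in> G"
        "\<And>m. (\<zero>\<^bsub>B\<^esub>, m) \<in> G \<Longrightarrow> m = \<zero>\<^bsub>M\<^esub>" for G
      unfolding partial_def by (intro conjI allI impI ballI) (fact that | erule that | (erule that(3-), assumption) )+
    have fz: "f \<zero>\<^bsub>A\<^esub> = \<zero>\<^bsub>B\<^esub>" by (rule module_hom_zero[OF A B f])
    have gz: "g \<zero>\<^bsub>A\<^esub> = \<zero>\<^bsub>M\<^esub>" by (rule module_hom_zero[OF A M g])
    have base: "partial ((\<lambda>x. (f x, g x)) ` carrier A)"
    proof (rule pI)
      fix m assume "(\<zero>\<^bsub>B\<^esub>, m) \<in> (\<lambda>x. (f x, g x)) ` carrier A"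
      then obtain x where x: "x \<in> carrier A" "f x = \<zero>\<^bsub>B\<^esub>" "m = g x" by auto
      then have "x = \<zero>\<^bsub>A\<^esub>" using inj fz by (metis A.zero_closed inj_on_eq_iff)
      then show "m = \<zero>\<^bsub>M\<^esub>" using x gz by simp
    next
      fix x m y n assume "(x, m) \<in> (\<lambda>x. (f x, g x)) ` carrier A" "(y, n) \<in> (\<lambda>x. (f x, g x)) ` carrier A"
      then obtain u v where "u \<in> carrier A" "v \<in> carrier A" "x = f u" "m = g u" "y = f v" "n = g v"
        by auto
      then show "(x \<oplus>\<^bsub>B\<^esub> y, m \<oplus>\<^bsub>M\<^esub> n) \<in> (\<lambda>x. (f x, g x)) ` carrier A"
        by (intro image_eqI[of _ _ "u \<oplus>\<^bsub>A\<^esub> v"]) (auto simp: f' g')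
    next
      fix r x m assume "r \<in> carrier R" "(x, m) \<in> (\<lambda>x. (f x, g x)) ` carrier A"
      then obtain u where "u \<in> carrier A" "x = f u" "m = g u" by auto
      then show "(r \<odot>\<^bsub>B\<^esub> x, r \<odot>\<^bsub>M\<^esub> m) \<in> (\<lambda>x. (f x, g x)) ` carrier A"
        using \<open>r \<in> carrier R\<close> by (intro image_eqI[of _ _ "r \<odot>\<^bsub>A\<^esub> u"]) (auto simp: f' g')
    qed (auto simp: f' g')
    have "\<exists>G\<in>Collect partial. \<forall>X\<in>Collect partial. G \<subseteq> X \<longrightarrow> X = G"
    proof (rule subset_Zorn_nonempty)
      show "Collect partial \<noteq> {}" using base by blast
      fix C assume C: "C \<noteq> {}" "subset.chain (Collect partial) C"
      then have sub: "\<And>X. X \<in> C \<Longrightarrow> partial X" and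
        ch: "\<And>X Y. X \<in> C \<Longrightarrow> Y \<in> C \<Longrightarrow> X \<subseteq> Y \<or> Y \<subseteq> X"
        by (auto simp: subset_chain_def)
      have "partial (\<Union>C)"
      proof (rule pI)
        show "\<Union>C \<subseteq> carrier B \<times> carrier M" using sub unfolding partial_def by blast
        show "(\<lambda>x. (f x, g x)) ` carrier A \<subseteq> \<Union>C" using sub C(1) unfolding partial_def by blast
        fix x m y n assume "(x, m) \<in> \<Union>C" "(y, n) \<in> \<Union>C"
        then obtain X where "X \<in> C" "(x, m) \<in> X" "(y, n) \<in> X" using ch by blast
        then show "(x \<oplus>\<^bsub>B\<^esub> y, m \<oplus>\<^bsub>M\<^esub> n) \<in> \<Union>C" using sub[of X] unfolding partial_def by blast
      next
        fix r x m assume "r \<in> carrier R" "(x, m) \<in> \<Union>C"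
        then show "(r \<odot>\<^bsub>B\<^esub> x, r \<odot>\<^bsub>M\<^esub> m) \<in> \<Union>C" using sub unfolding partial_def by blast
      next
        fix m assume "(\<zero>\<^bsub>B\<^esub>, m) \<in> \<Union>C"
        then show "m = \<zero>\<^bsub>M\<^esub>" using sub unfolding partial_def by blast
      qed
      then show "\<Union>C \<in> Collect partial" by simp
    qed
    then obtain G where G: "partial G" and max: "\<And>X. partial X \<Longrightarrow> G \<subseteq> X \<Longrightarrow> X = G" by blast
    have Gc: "\<And>x m. (x, m) \<in> G \<Longrightarrow> x \<in> carrier B \<and> m \<in> carrier M"
      and Gb: "\<And>x. x \<in> carrier A \<Longrightarrow> (f x, g x) \<in> G"
      and Ga: "\<And>x m y n. (x, m) \<in> G \<Longrightarrow> (y, n) \<in> G \<Longrightarrow> (x \<oplus>\<^bsub>B\<^esub> y, m \<oplus>\<^bsub>M\<^esub> n) \<in> G"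
      and Gs: "\<And>r x m. r \<in> carrier R \<Longrightarrow> (x, m) \<in> G \<Longrightarrow> (r \<odot>\<^bsub>B\<^esub> x, r \<odot>\<^bsub>M\<^esub> m) \<in> G"
      and Gz: "\<And>m. (\<zero>\<^bsub>B\<^esub>, m) \<in> G \<Longrightarrow> m = \<zero>\<^bsub>M\<^esub>"
      using G unfolding partial_def by blast+
    have G0: "(\<zero>\<^bsub>B\<^esub>, \<zero>\<^bsub>M\<^esub>) \<in> G" using Gb[of "\<zero>\<^bsub>A\<^esub>"] fz gz by simp
    have Gm: "(\<ominus>\<^bsub>B\<^esub> x, \<ominus>\<^bsub>M\<^esub> m) \<in> G" if "(x, m) \<in> G" for x m
      using Gs[of "\<ominus>\<^bsub>R\<^esub> \<one>\<^bsub>R\<^esub>", OF _ that] Gc[OF that] by (simp add: B.smult_l_minus M.smult_l_minus)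
    have Gu: "m = n" if "(x, m) \<in> G" "(x, n) \<in> G" for x m n
    proof -
      have "(x \<oplus>\<^bsub>B\<^esub> \<ominus>\<^bsub>B\<^esub> x, m \<oplus>\<^bsub>M\<^esub> \<ominus>\<^bsub>M\<^esub> n) \<in> G" using Ga Gm that by blast
      then have "m \<oplus>\<^bsub>M\<^esub> \<ominus>\<^bsub>M\<^esub> n = \<zero>\<^bsub>M\<^esub>" using Gz Gc that by (metis B.M.r_neg)
      then show ?thesis using Gc that
        by (metis M.M.minus_equality M.M.minus_minus M.M.a_inv_closed)
    qed
    have dom: "\<exists>m. (b, m) \<in> G" if b: "b \<in> carrier B" for b
    proof -
      define I where "I = {r \<in> carrier R. \<exists>m. (r \<odot>\<^bsub>B\<^esub> b, m) \<in> G}"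
      define v where "v r = (THE m. (r \<odot>\<^bsub>B\<^esub> b, m) \<in> G)" for r
      have v: "v r = m" if "(r \<odot>\<^bsub>B\<^esub> b, m) \<in> G" for r m
        unfolding v_def using that Gu by blast
      have v': "(r \<odot>\<^bsub>B\<^esub> b, v r) \<in> G" if "r \<in> I" for r
        using that v unfolding I_def by auto
      have Ic: "r \<in> carrier R" if "r \<in> I" for r using that by (simp add: I_def)
      have add: "((r \<oplus>\<^bsub>R\<^esub> s) \<odot>\<^bsub>B\<^esub> b, v r \<oplus>\<^bsub>M\<^esub> v s) \<in> G" if "r \<in> I" "s \<in> I" for r s
        using Ga[OF v'[OF that(1)] v'[OF that(2)]] that b by (simp add: B.smult_l_distr Ic)
      have mul: "((r \<otimes>\<^bsub>R\<^esub> s) \<odot>\<^bsub>B\<^esub> b, r \<odot>\<^bsub>M\<^esub> v s) \<in> G" if "r \<in> carrier R" "s \<in> I" for r s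
        using Gs[OF that(1) v'[OF that(2)]] that b by (simp add: B.smult_assoc1 Ic)
      have mulI: "r \<otimes>\<^bsub>R\<^esub> s \<in> I" if "r \<in> carrier R" "s \<in> I" for r s
        unfolding I_def using mul[OF that] M.R.m_closed[OF that(1) Ic[OF that(2)]] by blast
      have addI: "r \<oplus>\<^bsub>R\<^esub> s \<in> I" if "r \<in> I" "s \<in> I" for r s
        unfolding I_def using add[OF that] M.R.a_closed[OF Ic[OF that(1)] Ic[OF that(2)]] by blast
      have zI: "\<zero>\<^bsub>R\<^esub> \<in> I" using G0 b by (auto simp: I_def)
      have I: "ideal I R"
      proof (rule idealI)
        show "ring R" by (rule M.R.ring_axioms)
        show "subgroup I (add_monoid R)"
        proof (rule subgroup.intro)
          show "I \<subseteq> carrier (add_monoid R)" by (auto simp: I_def)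
          show "\<And>x y. x \<in> I \<Longrightarrow> y \<in> I \<Longrightarrow> x \<otimes>\<^bsub>add_monoid R\<^esub> y \<in> I"
            by (simp add: addI)
          show "\<one>\<^bsub>add_monoid R\<^esub> \<in> I" using zI by simp
          fix x assume x: "x \<in> I"
          have "\<ominus>\<^bsub>R\<^esub> x = (\<ominus>\<^bsub>R\<^esub> \<one>\<^bsub>R\<^esub>) \<otimes>\<^bsub>R\<^esub> x"
            using Ic[OF x] by (simp add: M.R.l_minus)
          then show "inv\<^bsub>add_monoid R\<^esub> x \<in> I"
            using mulI[of "\<ominus>\<^bsub>R\<^esub> \<one>\<^bsub>R\<^esub>" x] x by (simp add: a_inv_def)
        qed
        fix a x assume "a \<in> I" "x \<in> carrier R"
        then show "x \<otimes>\<^bsub>R\<^esub> a \<in> I" by (rule mulI[rotated])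
        then show "a \<otimes>\<^bsub>R\<^esub> x \<in> I" using M.R.m_comm \<open>a \<in> I\<close> \<open>x \<in> carrier R\<close> Ic by metis
      qed
      have "v \<in> module_hom R (ideal_module R I) M"
        by (rule module_homI) (auto simp: ideal_module_def Gc[OF v'] v[OF add] v[OF mul])
      moreover have "id \<in> module_hom R (ideal_module R I) (ideal_module R (carrier R))"
        by (rule module_homI) (auto simp: ideal_module_def Ic)
      ultimately obtain h where h: "h \<in> module_hom R (ideal_module R (carrier R)) M"
        and hv: "\<And>x. x \<in> I \<Longrightarrow> h x = v x"
        using assms ideal_module[OF M.R.is_cring I] ideal_module[OF M.R.is_cring M.R.oneideal]
        unfolding injective_module_def
        by (force simp: ideal_module_def)
      define e where "e = h \<one>\<^bsub>R\<^esub>"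
      have e: "e \<in> carrier M" unfolding e_def
        using module_homD(1)[OF h] by (simp add: ideal_module_def)
      have he: "h r = r \<odot>\<^bsub>M\<^esub> e" if "r \<in> carrier R" for r
        using module_homD(3)[OF h, of r "\<one>\<^bsub>R\<^esub>"] that by (simp add: ideal_module_def e_def)
      define G' where "G' = {(d \<oplus>\<^bsub>B\<^esub> r \<odot>\<^bsub>B\<^esub> b, m \<oplus>\<^bsub>M\<^esub> r \<odot>\<^bsub>M\<^esub> e) | d m r. (d, m) \<in> G \<and> r \<in> carrier R}"
      have G'I: "(d \<oplus>\<^bsub>B\<^esub> r \<odot>\<^bsub>B\<^esub> b, m \<oplus>\<^bsub>M\<^esub> r \<odot>\<^bsub>M\<^esub> e) \<in> G'" if "(d, m) \<in> G" "r \<in> carrier R" for d m r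
        using that unfolding G'_def by blast
      have sub: "G \<subseteq> G'"
      proof (rule subrelI)
        fix d m assume "(d, m) \<in> G"
        from G'I[OF this M.R.zero_closed] Gc[OF this] show "(d, m) \<in> G'" using b e by simp
      qed
      have "partial G'"
      proof (rule pI)
        show "G' \<subseteq> carrier B \<times> carrier M" unfolding G'_def using Gc b e by auto
        show "(\<lambda>x. (f x, g x)) ` carrier A \<subseteq> G'" using sub Gb by blast
        fix x m y n assume "(x, m) \<in> G'" "(y, n) \<in> G'"
        then obtain d p r d' p' r' where *: "(d, p) \<in> G" "r \<in> carrier R" "(d', p') \<in> G" "r' \<in> carrier R"
          "x = d \<oplus>\<^bsub>B\<^esub> r \<odot>\<^bsub>B\<^esub> b" "m = p \<oplus>\<^bsub>M\<^esub> r \<odot>\<^bsub>M\<^esub> e"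
          "y = d' \<oplus>\<^bsub>B\<^esub> r' \<odot>\<^bsub>B\<^esub> b" "n = p' \<oplus>\<^bsub>M\<^esub> r' \<odot>\<^bsub>M\<^esub> e"
          unfolding G'_def by blast
        have "x \<oplus>\<^bsub>B\<^esub> y = (d \<oplus>\<^bsub>B\<^esub> d') \<oplus>\<^bsub>B\<^esub> (r \<oplus>\<^bsub>R\<^esub> r') \<odot>\<^bsub>B\<^esub> b"
          using * Gc b by (simp add: B.smult_l_distr B.M.a_assoc B.M.a_comm B.M.a_lcomm)
        moreover have "m \<oplus>\<^bsub>M\<^esub> n = (p \<oplus>\<^bsub>M\<^esub> p') \<oplus>\<^bsub>M\<^esub> (r \<oplus>\<^bsub>R\<^esub> r') \<odot>\<^bsub>M\<^esub> e"
          using * Gc e by (simp add: M.smult_l_distr M.M.a_assoc M.M.a_comm M.M.a_lcomm)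
        ultimately show "(x \<oplus>\<^bsub>B\<^esub> y, m \<oplus>\<^bsub>M\<^esub> n) \<in> G'"
          using G'I[OF Ga[OF *(1,3)]] * by simp
      next
        fix s x m assume s: "s \<in> carrier R" and "(x, m) \<in> G'"
        then obtain d p r where *: "(d, p) \<in> G" "r \<in> carrier R"
          "x = d \<oplus>\<^bsub>B\<^esub> r \<odot>\<^bsub>B\<^esub> b" "m = p \<oplus>\<^bsub>M\<^esub> r \<odot>\<^bsub>M\<^esub> e"
          unfolding G'_def by blast
        have "s \<odot>\<^bsub>B\<^esub> x = s \<odot>\<^bsub>B\<^esub> d \<oplus>\<^bsub>B\<^esub> (s \<otimes>\<^bsub>R\<^esub> r) \<odot>\<^bsub>B\<^esub> b"
          using * s Gc b by (simp add: B.smult_r_distr B.smult_assoc1)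
        moreover have "s \<odot>\<^bsub>M\<^esub> m = s \<odot>\<^bsub>M\<^esub> p \<oplus>\<^bsub>M\<^esub> (s \<otimes>\<^bsub>R\<^esub> r) \<odot>\<^bsub>M\<^esub> e"
          using * s Gc e by (simp add: M.smult_r_distr M.smult_assoc1)
        ultimately show "(s \<odot>\<^bsub>B\<^esub> x, s \<odot>\<^bsub>M\<^esub> m) \<in> G'"
          using G'I[OF Gs[OF s *(1)]] * s by simp
      next
        fix m assume "(\<zero>\<^bsub>B\<^esub>, m) \<in> G'"
        then obtain d p r where *: "(d, p) \<in> G" "r \<in> carrier R"
          "\<zero>\<^bsub>B\<^esub> = d \<oplus>\<^bsub>B\<^esub> r \<odot>\<^bsub>B\<^esub> b" "m = p \<oplus>\<^bsub>M\<^esub> r \<odot>\<^bsub>M\<^esub> e"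
          unfolding G'_def by blast
        have c: "d \<in> carrier B" "p \<in> carrier M" using Gc * by auto
        have "r \<odot>\<^bsub>B\<^esub> b = \<ominus>\<^bsub>B\<^esub> d"
          using * c b by (metis B.M.minus_equality B.M.a_comm B.smult_closed)
        then have rd: "(r \<odot>\<^bsub>B\<^esub> b, \<ominus>\<^bsub>M\<^esub> p) \<in> G" using Gm[OF *(1)] by simp
        then have "r \<in> I" using * by (auto simp: I_def)
        then have "r \<odot>\<^bsub>M\<^esub> e = \<ominus>\<^bsub>M\<^esub> p" using he hv v[OF rd] * by metis
        then show "m = \<zero>\<^bsub>M\<^esub>" using * c by (simp add: M.M.r_neg)
      qed
      then have "G' = G" using max sub by blast
      moreover have "(b, e) \<in> G'" using G'I[OF G0 M.R.one_closed] b e by simp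
      ultimately show ?thesis by blast
    qed
    define h where "h b = (THE m. (b, m) \<in> G)" for b
    have h: "h b = m" if "(b, m) \<in> G" for b m
      unfolding h_def using that Gu by blast
    have h': "(b, h b) \<in> G" if "b \<in> carrier B" for b
      using dom[OF that] h by auto
    have "h \<in> module_hom R B M"
      by (rule module_homI) (auto simp: Gc[OF h'] h[OF Ga[OF h' h']] h[OF Gs[OF _ h']])
    moreover have "\<forall>x\<in>carrier A. h (f x) = g x" using h Gb by blast
    ultimately show "\<exists>h\<in>module_hom R B M. \<forall>x\<in>carrier A. h (f x) = g x" by blast
  qed
qed

lemma tensor_relators_carrier:
  assumes "module R M" "module R N"
  shows "tensor_relators R M N \<subseteq> carrier (free_Abelian_group (carrier M \<times> carrier N))"
proof -
  interpret M: module R M by fact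
  interpret N: module R N by fact
  show ?thesis
    unfolding tensor_relators_def
    by (auto dest!: subsetD[OF keys_diff])
qed

lemma tensor_kernel_normal:
  assumes "module R M" "module R N"
  shows "tensor_kernel R M N \<lhd> free_Abelian_group (carrier M \<times> carrier N)"
  unfolding tensor_kernel_def
  by (intro comm_group.subgroup_imp_normal abelian_free_Abelian_group
      group.generate_is_subgroup group_free_Abelian_group tensor_relators_carrier assms)

lemma tensor_map_coset:
  assumes A: "module R A" and B: "module R B" and N: "module R N" and f: "f \<in> module_hom R A B"
    and c: "c \<in> carrier (free_Abelian_group (carrier A \<times> carrier N))"
  shows "frag_extend (\<lambda>(x, y). frag_of (f x, y)) c
      \<in> carrier (free_Abelian_group (carrier B \<times> carrier N))" (is "?\<phi> c \<in> carrier ?FB")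
    and "tensor_map R A B N f
        (tensor_kernel R A N #>\<^bsub>free_Abelian_group (carrier A \<times> carrier N)\<^esub> c) =
      tensor_kernel R B N #>\<^bsub>free_Abelian_group (carrier B \<times> carrier N)\<^esub>
        frag_extend (\<lambda>(x, y). frag_of (f x, y)) c"
proof -
  let ?FA = "free_Abelian_group (carrier A \<times> carrier N)"
  interpret KA: normal "tensor_kernel R A N" ?FA by (rule tensor_kernel_normal[OF A N])
  interpret KB: normal "tensor_kernel R B N" ?FB by (rule tensor_kernel_normal[OF B N])
  note f' = module_homD[OF f]
  have closed: "?\<phi> d \<in> carrier ?FB" if d: "d \<in> carrier ?FA" for d
  proof -
    have "Poly_Mapping.keys (?\<phi> d) \<subseteq> (\<Union>p \<in> Poly_Mapping.keys d. Poly_Mapping.keys (case p of (x, y) \<Rightarrow> frag_of (f x, y)))"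
      by (rule keys_frag_extend)
    also have "\<dots> \<subseteq> carrier B \<times> carrier N"
    proof (rule UN_least)
      fix p assume "p \<in> Poly_Mapping.keys d"
      then obtain x y where "p = (x, y)" "x \<in> carrier A" "y \<in> carrier N"
        using d by (cases p) auto
      then show "Poly_Mapping.keys (case p of (x, y) \<Rightarrow> frag_of (f x, y)) \<subseteq> carrier B \<times> carrier N"
        using f'(1) by simp
    qed
    finally show ?thesis by simp
  qed
  then show "?\<phi> c \<in> carrier ?FB" using c by blast
  have rel: "?\<phi> d \<in> tensor_relators R B N" if "d \<in> tensor_relators R A N" for d
    using that unfolding tensor_relators_def
    by (elim UnE CollectE exE conjE) (simp only: frag_extend_diff frag_extend_of prod.case f', blast intro: f'(1))+
  have ker: "?\<phi> d \<in> tensor_kernel R B N" if "d \<in> tensor_kernel R A N" for d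
    using that unfolding tensor_kernel_def
  proof (induction rule: generate.induct)
    case one
    then show ?case using generate.one[of ?FB] by simp
  next
    case (incl h)
    then show ?case by (intro generate.incl rel)
  next
    case (inv h)
    have "?\<phi> h \<in> generate ?FB (tensor_relators R B N)" by (intro generate.incl rel inv)
    have "h \<in> carrier ?FA" using inv tensor_relators_carrier[OF A N] by blast
    then have "?\<phi> (inv\<^bsub>?FA\<^esub> h) = inv\<^bsub>?FB\<^esub> ?\<phi> h"
      using closed[of h] by (simp add: frag_extend_minus)
    then show ?case by (simp only:) (intro generate.inv rel inv)
  next
    case (eng h1 h2)
    then show ?case
      using generate.eng[of "?\<phi> h1" ?FB _ "?\<phi> h2"] by (simp add: frag_extend_add)
  qed
  have "?\<phi> (k + c) \<in> tensor_kernel R B N #>\<^bsub>?FB\<^esub> ?\<phi> c" if "k \<in> tensor_kernel R A N" for k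
    using ker[OF that] by (auto simp: r_coset_def frag_extend_add)
  then have eq: "tensor_kernel R B N #>\<^bsub>?FB\<^esub> ?\<phi> (k + c) = tensor_kernel R B N #>\<^bsub>?FB\<^esub> ?\<phi> c"
    if "k \<in> tensor_kernel R A N" for k
    using that KB.repr_independence[OF _ closed[OF c] KB.subgroup_axioms] by metis
  have ne: "tensor_kernel R A N \<noteq> {}" using subgroup.one_closed[OF KA.subgroup_axioms] by blast
  have "tensor_kernel R A N #>\<^bsub>?FA\<^esub> c = (\<lambda>k. k + c) ` tensor_kernel R A N"
    by (auto simp: r_coset_def)
  then have "tensor_map R A B N f (tensor_kernel R A N #>\<^bsub>?FA\<^esub> c) =
      (\<Union>k \<in> tensor_kernel R A N. tensor_kernel R B N #>\<^bsub>?FB\<^esub> ?\<phi> (k + c))"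
    by (simp add: tensor_map_def)
  also have "\<dots> = (\<Union>k \<in> tensor_kernel R A N. tensor_kernel R B N #>\<^bsub>?FB\<^esub> ?\<phi> c)"
    by (intro SUP_cong refl eq)
  also have "\<dots> = tensor_kernel R B N #>\<^bsub>?FB\<^esub> ?\<phi> c"
    using ne by (rule UN_constant[THEN trans, OF if_not_P])
  finally show "tensor_map R A B N f (tensor_kernel R A N #>\<^bsub>?FA\<^esub> c) =
      tensor_kernel R B N #>\<^bsub>?FB\<^esub> ?\<phi> c" .
qed

lemma tensor_map_pure_tensor:
  assumes "module R A" "module R B" "module R N" "f \<in> module_hom R A B"
    and "x \<in> carrier A" "y \<in> carrier N"
  shows "tensor_map R A B N f (pure_tensor R A N x y) = pure_tensor R B N (f x) y"
  unfolding pure_tensor_def using assms by (subst tensor_map_coset(2)[OF assms(1-4)]) auto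

lemma tensor_map_hom:
  assumes A: "module R A" and B: "module R B" and N: "module R N" and f: "f \<in> module_hom R A B"
  shows "tensor_map R A B N f \<in> hom (tensor_product R A N) (tensor_product R B N)"
proof (rule homI)
  let ?FA = "free_Abelian_group (carrier A \<times> carrier N)"
  let ?FB = "free_Abelian_group (carrier B \<times> carrier N)"
  let ?\<phi> = "frag_extend (\<lambda>(x, y). frag_of (f x, y))"
  interpret KA: normal "tensor_kernel R A N" ?FA by (rule tensor_kernel_normal[OF A N])
  interpret KB: normal "tensor_kernel R B N" ?FB by (rule tensor_kernel_normal[OF B N])
  note tm = tensor_map_coset[OF A B N f]
  fix U assume "U \<in> carrier (tensor_product R A N)"
  then obtain c where c: "c \<in> carrier ?FA" "U = tensor_kernel R A N #>\<^bsub>?FA\<^esub> c"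
    by (auto simp: tensor_product_def FactGroup_def RCOSETS_def)
  have "tensor_map R A B N f U = tensor_kernel R B N #>\<^bsub>?FB\<^esub> ?\<phi> c"
    using c tm by simp
  then show "tensor_map R A B N f U \<in> carrier (tensor_product R B N)"
    using tm(1)[OF c(1)] by (auto simp: tensor_product_def FactGroup_def RCOSETS_def)
  fix V assume "V \<in> carrier (tensor_product R A N)"
  then obtain d where d: "d \<in> carrier ?FA" "V = tensor_kernel R A N #>\<^bsub>?FA\<^esub> d"
    by (auto simp: tensor_product_def FactGroup_def RCOSETS_def)
  have "tensor_map R A B N f (U <#>\<^bsub>?FA\<^esub> V) =
      tensor_map R A B N f (tensor_kernel R A N #>\<^bsub>?FA\<^esub> (c \<otimes>\<^bsub>?FA\<^esub> d))"
    using KA.rcos_sum[OF c(1) d(1)] c d by simp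
  also have "\<dots> = tensor_kernel R B N #>\<^bsub>?FB\<^esub> ?\<phi> (c \<otimes>\<^bsub>?FA\<^esub> d)"
    by (rule tm(2)[OF monoid.m_closed[OF group.is_monoid[OF group_free_Abelian_group] c(1) d(1)]])
  also have "?\<phi> (c \<otimes>\<^bsub>?FA\<^esub> d) = ?\<phi> c \<otimes>\<^bsub>?FB\<^esub> ?\<phi> d"
    by (simp add: frag_extend_add)
  also have "tensor_kernel R B N #>\<^bsub>?FB\<^esub> (?\<phi> c \<otimes>\<^bsub>?FB\<^esub> ?\<phi> d) =
      tensor_map R A B N f U <#>\<^bsub>?FB\<^esub> tensor_map R A B N f V"
    using KB.rcos_sum[OF tm(1)[OF c(1)] tm(1)[OF d(1)]] tm(2) c d by simp
  finally show "tensor_map R A B N f (U \<otimes>\<^bsub>tensor_product R A N\<^esub> V) =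
      tensor_map R A B N f U \<otimes>\<^bsub>tensor_product R B N\<^esub> tensor_map R A B N f V"
    by (simp add: tensor_product_def FactGroup_def)
qed

context
  fixes R :: "('a, 'b) ring_scheme" (structure) and S :: "'a set"
  assumes R: "cring R" and S: "submonoid S R"
begin

interpretation cring R by (rule R)

lemma fraction_denom: "s \<in> S \<Longrightarrow> s \<in> carrier R" "\<one> \<in> S"
    "s \<in> S \<Longrightarrow> t \<in> S \<Longrightarrow> s \<otimes> t \<in> S"
  using S unfolding submonoid_def by blast+

lemma equiv_fraction_rel: "equiv (carrier R \<times> S) (fraction_rel R S)"
proof (rule equivI)
  show "fraction_rel R S \<subseteq> (carrier R \<times> S) \<times> carrier R \<times> S"
    unfolding fraction_rel_def by blast
  show "refl_on (carrier R \<times> S) (fraction_rel R S)"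
    using fraction_denom(2) unfolding refl_on_def fraction_rel_def by blast
  show "sym (fraction_rel R S)"
    unfolding sym_def fraction_rel_def by (clarsimp, metis)
  show "trans (fraction_rel R S)"
  proof (rule transI, clarsimp simp: fraction_rel_def)
    fix a s b t c w u v
    assume *: "a \<in> carrier R" "b \<in> carrier R" "c \<in> carrier R" "s \<in> S" "t \<in> S" "w \<in> S" "u \<in> S" "v \<in> S"
      and 1: "u \<otimes> (t \<otimes> a) = u \<otimes> (s \<otimes> b)" and 2: "v \<otimes> (w \<otimes> b) = v \<otimes> (t \<otimes> c)"
    note c = *(1-3) *(4-8)[THEN fraction_denom(1)]
    have "(u \<otimes> v \<otimes> t) \<otimes> (w \<otimes> a) = v \<otimes> w \<otimes> (u \<otimes> (t \<otimes> a))" using c by (simp add: m_ac)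
    also have "\<dots> = v \<otimes> w \<otimes> (u \<otimes> (s \<otimes> b))" by (simp only: 1)
    also have "\<dots> = u \<otimes> s \<otimes> (v \<otimes> (w \<otimes> b))" using c by (simp add: m_ac)
    also have "\<dots> = u \<otimes> s \<otimes> (v \<otimes> (t \<otimes> c))" by (simp only: 2)
    also have "\<dots> = (u \<otimes> v \<otimes> t) \<otimes> (s \<otimes> c)" using c by (simp add: m_ac)
    finally show "\<exists>u\<in>S. u \<otimes> (w \<otimes> a) = u \<otimes> (s \<otimes> c)"
      using * by (intro bexI[of _ "u \<otimes> v \<otimes> t"] fraction_denom)
  qed
qed

lemma fraction_eq_iff:
  assumes "a \<in> carrier R" "b \<in> carrier R" "s \<in> S" "t \<in> S"
  shows "fraction R S a s = fraction R S b t \<longleftrightarrow> (\<exists>u\<in>S. u \<otimes> (t \<otimes> a) = u \<otimes> (s \<otimes> b))"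
proof -
  have "fraction R S a s = fraction R S b t \<longleftrightarrow> ((a, s), (b, t)) \<in> fraction_rel R S"
    unfolding fraction_def using eq_equiv_class_iff[OF equiv_fraction_rel] assms by blast
  then show ?thesis using assms by (simp add: fraction_rel_def)
qed

lemma fraction_mem:
  assumes "a \<in> carrier R" "s \<in> S"
  shows "(a, s) \<in> fraction R S a s"
  using assms equiv_class_self[OF equiv_fraction_rel] unfolding fraction_def by blast

lemma fraction_memD:
  assumes "(a', s') \<in> fraction R S a s"
  shows "a' \<in> carrier R" "s' \<in> S" "a \<in> carrier R" "s \<in> S"
    "\<exists>u\<in>S. u \<otimes> (s' \<otimes> a) = u \<otimes> (s \<otimes> a')"
  using assms unfolding fraction_def fraction_rel_def by auto

lemma fraction_mult:
  assumes "a \<in> carrier R" "b \<in> carrier R" "s \<in> S" "t \<in> S"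
  shows "fraction R S a s \<otimes>\<^bsub>localization R S\<^esub> fraction R S b t = fraction R S (a \<otimes> b) (s \<otimes> t)"
proof -
  have "fraction R S (a' \<otimes> b') (s' \<otimes> t') = fraction R S (a \<otimes> b) (s \<otimes> t)"
    if "(a', s') \<in> fraction R S a s" "(b', t') \<in> fraction R S b t" for a' s' b' t'
  proof -
    note 1 = fraction_memD[OF that(1)] and 2 = fraction_memD[OF that(2)]
    obtain u v where u: "u \<in> S" "u \<otimes> (s' \<otimes> a) = u \<otimes> (s \<otimes> a')"
      and v: "v \<in> S" "v \<otimes> (t' \<otimes> b) = v \<otimes> (t \<otimes> b')" using 1 2 by blast
    note c = 1(1,3) 2(1,3) 1(2,4)[THEN fraction_denom(1)] 2(2,4)[THEN fraction_denom(1)]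
      u(1)[THEN fraction_denom(1)] v(1)[THEN fraction_denom(1)]
    have "(u \<otimes> v) \<otimes> ((s \<otimes> t) \<otimes> (a' \<otimes> b')) = (u \<otimes> (s \<otimes> a')) \<otimes> (v \<otimes> (t \<otimes> b'))"
      using c by (simp add: m_ac)
    also have "\<dots> = (u \<otimes> (s' \<otimes> a)) \<otimes> (v \<otimes> (t' \<otimes> b))" using u v by simp
    also have "\<dots> = (u \<otimes> v) \<otimes> ((s' \<otimes> t') \<otimes> (a \<otimes> b))" using c by (simp add: m_ac)
    finally have "\<exists>w\<in>S. w \<otimes> ((s \<otimes> t) \<otimes> (a' \<otimes> b')) = w \<otimes> ((s' \<otimes> t') \<otimes> (a \<otimes> b))"
      using fraction_denom(3)[OF u(1) v(1)] by blast
    then show ?thesis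
      using fraction_eq_iff[of "a' \<otimes> b'" "a \<otimes> b" "s' \<otimes> t'" "s \<otimes> t"] 1 2
        fraction_denom(3) m_closed by blast
  qed
  then have "(\<Union>(a', s')\<in>fraction R S a s. (\<Union>(b', t')\<in>fraction R S b t.
      fraction R S (a' \<otimes> b') (s' \<otimes> t'))) = fraction R S (a \<otimes> b) (s \<otimes> t)"
    using fraction_mem[of a s] fraction_mem[of b t] assms by blast
  then show ?thesis by (simp add: localization_def)
qed

lemma fraction_add:
  assumes "a \<in> carrier R" "b \<in> carrier R" "s \<in> S" "t \<in> S"
  shows "fraction R S a s \<oplus>\<^bsub>localization R S\<^esub> fraction R S b t =
    fraction R S (t \<otimes> a \<oplus> s \<otimes> b) (s \<otimes> t)"
proof -
  have "fraction R S (t' \<otimes> a' \<oplus> s' \<otimes> b') (s' \<otimes> t') = fraction R S (t \<otimes> a \<oplus> s \<otimes> b) (s \<otimes> t)"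
    if "(a', s') \<in> fraction R S a s" "(b', t') \<in> fraction R S b t" for a' s' b' t'
  proof -
    note 1 = fraction_memD[OF that(1)] and 2 = fraction_memD[OF that(2)]
    obtain u v where u: "u \<in> S" "u \<otimes> (s' \<otimes> a) = u \<otimes> (s \<otimes> a')"
      and v: "v \<in> S" "v \<otimes> (t' \<otimes> b) = v \<otimes> (t \<otimes> b')" using 1 2 by blast
    note c = 1(1,3) 2(1,3) 1(2,4)[THEN fraction_denom(1)] 2(2,4)[THEN fraction_denom(1)]
      u(1)[THEN fraction_denom(1)] v(1)[THEN fraction_denom(1)]
    have "(u \<otimes> v) \<otimes> ((s \<otimes> t) \<otimes> (t' \<otimes> a' \<oplus> s' \<otimes> b')) =
        (v \<otimes> t \<otimes> t') \<otimes> (u \<otimes> (s \<otimes> a')) \<oplus> (u \<otimes> s \<otimes> s') \<otimes> (v \<otimes> (t \<otimes> b'))"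
      using c by (simp add: r_distr m_ac)
    also have "\<dots> = (v \<otimes> t \<otimes> t') \<otimes> (u \<otimes> (s' \<otimes> a)) \<oplus> (u \<otimes> s \<otimes> s') \<otimes> (v \<otimes> (t' \<otimes> b))"
      using u v by simp
    also have "\<dots> = (u \<otimes> v) \<otimes> ((s' \<otimes> t') \<otimes> (t \<otimes> a \<oplus> s \<otimes> b))"
      using c by (simp add: r_distr m_ac)
    finally have "\<exists>w\<in>S. w \<otimes> ((s \<otimes> t) \<otimes> (t' \<otimes> a' \<oplus> s' \<otimes> b')) =
        w \<otimes> ((s' \<otimes> t') \<otimes> (t \<otimes> a \<oplus> s \<otimes> b))"
      using fraction_denom(3)[OF u(1) v(1)] by blast
    then show ?thesis
      using fraction_eq_iff[of "t' \<otimes> a' \<oplus> s' \<otimes> b'" "t \<otimes> a \<oplus> s \<otimes> b" "s' \<otimes> t'" "s \<otimes> t"] 1 2 c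
        fraction_denom(3) m_closed a_closed by blast
  qed
  then have "(\<Union>(a', s')\<in>fraction R S a s. (\<Union>(b', t')\<in>fraction R S b t.
      fraction R S (t' \<otimes> a' \<oplus> s' \<otimes> b') (s' \<otimes> t'))) = fraction R S (t \<otimes> a \<oplus> s \<otimes> b) (s \<otimes> t)"
    using fraction_mem[of a s] fraction_mem[of b t] assms by blast
  then show ?thesis by (simp add: localization_def)
qed

lemma localization_carrier:
  "carrier (localization R S) = {fraction R S a s | a s. a \<in> carrier R \<and> s \<in> S}"
  by (auto simp: localization_def quotient_def fraction_def)

lemma localization_zero: "\<zero>\<^bsub>localization R S\<^esub> = fraction R S \<zero> \<one>"
  and localization_one: "\<one>\<^bsub>localization R S\<^esub> = fraction R S \<one> \<one>"
  by (simp_all add: localization_def)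

lemma fraction_eqI:
  assumes "a \<in> carrier R" "b \<in> carrier R" "s \<in> S" "t \<in> S" "t \<otimes> a = s \<otimes> b"
  shows "fraction R S a s = fraction R S b t"
  using fraction_eq_iff[OF assms(1-4)] assms(5) fraction_denom(2) by auto

lemma localization_cring: "cring (localization R S)"
proof (rule cringI)
  let ?L = "localization R S"
  note simps = fraction_mult fraction_add localization_zero localization_one fraction_denom
  have LE: thesis if "x \<in> carrier ?L"
    "\<And>a s. \<lbrakk>a \<in> carrier R; s \<in> S; s \<in> carrier R; x = fraction R S a s\<rbrakk> \<Longrightarrow> thesis" for x thesis
    using that fraction_denom(1) unfolding localization_carrier by blast
  have LI: "fraction R S a s \<in> carrier ?L" if "a \<in> carrier R" "s \<in> S" for a s
    using that unfolding localization_carrier by blast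
  show "abelian_group ?L"
  proof (rule abelian_groupI)
    fix x y assume "x \<in> carrier ?L" "y \<in> carrier ?L"
    then show "x \<oplus>\<^bsub>?L\<^esub> y \<in> carrier ?L" by (elim LE) (simp add: simps LI)
    show "x \<oplus>\<^bsub>?L\<^esub> y = y \<oplus>\<^bsub>?L\<^esub> x"
      using \<open>x \<in> carrier ?L\<close> \<open>y \<in> carrier ?L\<close> by (elim LE) (simp add: simps m_comm a_comm)
  next
    show "\<zero>\<^bsub>?L\<^esub> \<in> carrier ?L" by (simp add: simps LI)
  next
    fix x y z assume "x \<in> carrier ?L" "y \<in> carrier ?L" "z \<in> carrier ?L"
    then show "x \<oplus>\<^bsub>?L\<^esub> y \<oplus>\<^bsub>?L\<^esub> z = x \<oplus>\<^bsub>?L\<^esub> (y \<oplus>\<^bsub>?L\<^esub> z)"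
      by (elim LE) (simp add: simps r_distr m_ac a_ac)
  next
    fix x assume "x \<in> carrier ?L"
    then show "\<zero>\<^bsub>?L\<^esub> \<oplus>\<^bsub>?L\<^esub> x = x" by (elim LE) (simp add: simps)
    show "\<exists>y\<in>carrier ?L. y \<oplus>\<^bsub>?L\<^esub> x = \<zero>\<^bsub>?L\<^esub>"
      using \<open>x \<in> carrier ?L\<close>
    proof (rule LE)
      fix a s assume as: "a \<in> carrier R" "s \<in> S" "s \<in> carrier R" and x: "x = fraction R S a s"
      have "fraction R S (\<ominus> a) s \<oplus>\<^bsub>?L\<^esub> x = fraction R S \<zero> (s \<otimes> s)"
        using as by (simp add: x simps r_minus l_neg)
      also have "\<dots> = \<zero>\<^bsub>?L\<^esub>"
        using as by (simp only: simps, intro fraction_eqI) (simp_all add: fraction_denom)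
      finally show ?thesis using LI[of "\<ominus> a" s] as by blast
    qed
  qed
  show "Group.comm_monoid ?L"
  proof (rule comm_monoidI)
    fix x y assume "x \<in> carrier ?L" "y \<in> carrier ?L"
    then show "x \<otimes>\<^bsub>?L\<^esub> y \<in> carrier ?L" by (elim LE) (simp add: simps LI)
    show "x \<otimes>\<^bsub>?L\<^esub> y = y \<otimes>\<^bsub>?L\<^esub> x"
      using \<open>x \<in> carrier ?L\<close> \<open>y \<in> carrier ?L\<close> by (elim LE) (simp add: simps m_comm)
  next
    show "\<one>\<^bsub>?L\<^esub> \<in> carrier ?L" by (simp add: simps LI)
  next
    fix x y z assume "x \<in> carrier ?L" "y \<in> carrier ?L" "z \<in> carrier ?L"
    then show "x \<otimes>\<^bsub>?L\<^esub> y \<otimes>\<^bsub>?L\<^esub> z = x \<otimes>\<^bsub>?L\<^esub> (y \<otimes>\<^bsub>?L\<^esub> z)"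
      by (elim LE) (simp add: simps m_assoc)
  next
    fix x assume "x \<in> carrier ?L"
    then show "\<one>\<^bsub>?L\<^esub> \<otimes>\<^bsub>?L\<^esub> x = x" by (elim LE) (simp add: simps)
  qed
  fix x y z assume "x \<in> carrier ?L" "y \<in> carrier ?L" "z \<in> carrier ?L"
  then show "(x \<oplus>\<^bsub>?L\<^esub> y) \<otimes>\<^bsub>?L\<^esub> z = x \<otimes>\<^bsub>?L\<^esub> z \<oplus>\<^bsub>?L\<^esub> y \<otimes>\<^bsub>?L\<^esub> z"
    by (elim LE, simp add: simps, intro fraction_eqI) (simp_all add: simps l_distr r_distr m_ac)
qed

end

lemma primeideal_compl_submonoid:
  assumes "primeideal J R"
  shows "submonoid (carrier R - J) R"
proof -
  interpret primeideal J R by fact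
  have "\<one>\<^bsub>R\<^esub> \<notin> J" using one_imp_carrier I_notcarr by blast
  then show ?thesis using I_prime by unfold_locales auto
qed

lemma zerodivisors_primeideal:
  assumes "valuation_ring R" "\<one>\<^bsub>R\<^esub> \<noteq> \<zero>\<^bsub>R\<^esub>"
  shows "primeideal (zerodivisors R) R"
proof -
  interpret cring R using assms(1) by (simp add: valuation_ring_def)
  have mul: "a \<otimes>\<^bsub>R\<^esub> z \<in> zerodivisors R" if "a \<in> carrier R" "z \<in> zerodivisors R" for a z
    using that unfolding zerodivisors_def by (auto simp: m_assoc)
  have sum: "a \<oplus>\<^bsub>R\<^esub> b \<in> zerodivisors R" if "a \<in> zerodivisors R" "b \<in> carrier R" "a \<in> carrier R"
    "PIdl\<^bsub>R\<^esub> b \<subseteq> PIdl\<^bsub>R\<^esub> a" for a b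
  proof -
    have "b \<in> PIdl\<^bsub>R\<^esub> a" using that(4) cgenideal_self[OF that(2)] by blast
    then obtain c where "c \<in> carrier R" "b = c \<otimes>\<^bsub>R\<^esub> a"
      by (auto simp: cgenideal_def)
    then have "a \<oplus>\<^bsub>R\<^esub> b = (\<one>\<^bsub>R\<^esub> \<oplus>\<^bsub>R\<^esub> c) \<otimes>\<^bsub>R\<^esub> a" using that by (simp add: l_distr)
    then show ?thesis using mul that \<open>c \<in> carrier R\<close> by simp
  qed
  have sub: "z \<in> carrier R" if "z \<in> zerodivisors R" for z
    using that by (simp add: zerodivisors_def)
  have "ideal (zerodivisors R) R"
  proof (rule idealI)
    show "ring R" by (rule ring_axioms)
    show "subgroup (zerodivisors R) (add_monoid R)"
    proof (rule subgroup.intro)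
      show "zerodivisors R \<subseteq> carrier (add_monoid R)" using sub by auto
      show "\<one>\<^bsub>add_monoid R\<^esub> \<in> zerodivisors R"
        using assms(2) by (auto simp: zerodivisors_def intro!: bexI[of _ "\<one>\<^bsub>R\<^esub>"])
      fix a assume a: "a \<in> zerodivisors R"
      have "\<ominus>\<^bsub>R\<^esub> a = (\<ominus>\<^bsub>R\<^esub> \<one>\<^bsub>R\<^esub>) \<otimes>\<^bsub>R\<^esub> a" using sub[OF a] by (simp add: l_minus)
      then show "inv\<^bsub>add_monoid R\<^esub> a \<in> zerodivisors R"
        using mul[OF _ a, of "\<ominus>\<^bsub>R\<^esub> \<one>\<^bsub>R\<^esub>"] by (simp add: a_inv_def)
      fix b assume b: "b \<in> zerodivisors R"
      have "PIdl\<^bsub>R\<^esub> b \<subseteq> PIdl\<^bsub>R\<^esub> a \<or> PIdl\<^bsub>R\<^esub> a \<subseteq> PIdl\<^bsub>R\<^esub> b"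
        using assms(1) cgenideal_ideal[OF sub[OF a]] cgenideal_ideal[OF sub[OF b]]
        unfolding valuation_ring_def by blast
      then show "a \<otimes>\<^bsub>add_monoid R\<^esub> b \<in> zerodivisors R"
        using sum[OF a sub[OF b] sub[OF a]] sum[OF b sub[OF a] sub[OF b]] a_comm[OF sub[OF a] sub[OF b]]
        by auto
    qed
    fix a x assume a: "a \<in> zerodivisors R" "x \<in> carrier R"
    show "x \<otimes>\<^bsub>R\<^esub> a \<in> zerodivisors R" by (rule mul[OF a(2,1)])
    then show "a \<otimes>\<^bsub>R\<^esub> x \<in> zerodivisors R" using m_comm[OF sub[OF a(1)] a(2)] by simp
  qed
  then show ?thesis
  proof (rule primeidealI)
    show "cring R" by (rule is_cring)
    have "\<one>\<^bsub>R\<^esub> \<notin> zerodivisors R" by (auto simp: zerodivisors_def)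
    then show "carrier R \<noteq> zerodivisors R" by blast
    fix a b assume ab: "a \<in> carrier R" "b \<in> carrier R" "a \<otimes>\<^bsub>R\<^esub> b \<in> zerodivisors R"
    then obtain x where x: "x \<in> carrier R" "x \<noteq> \<zero>\<^bsub>R\<^esub>" "a \<otimes>\<^bsub>R\<^esub> (b \<otimes>\<^bsub>R\<^esub> x) = \<zero>\<^bsub>R\<^esub>"
      by (auto simp: zerodivisors_def m_assoc)
    then show "a \<in> zerodivisors R \<or> b \<in> zerodivisors R"
      using ab by (cases "b \<otimes>\<^bsub>R\<^esub> x = \<zero>\<^bsub>R\<^esub>") (auto simp: zerodivisors_def)
  qed
qed

end

theory Submission
  imports Defs
begin

text \<open>
  Both rings are chain rings in which every element \<open>a\<close> has a partner \<open>b\<close> with \<open>a b = 0\<close>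
  such that the annihilator of \<open>b\<close> is generated by \<open>a\<close>: a nonzero element \<open>y\<close> of \<open>R\<close> that dies in the
  quotient or in the localization factors as \<open>y = a b\<close> unless \<open>a\<close> itself dies, and \<open>x b = 0 \<noteq> a b\<close>
  forces \<open>a\<close> to divide \<open>x\<close> in a valuation ring.

  Over such a ring, let \<open>E\<close> be injective and \<open>r e = 0\<close>. For a partner \<open>s\<close> of \<open>r\<close>, the map \<open>x s \<mapsto> x e\<close> is well
  defined on \<open>R s\<close> and extends to \<open>R\<close>, so \<open>e = s e'\<close> with \<open>r s = 0\<close>. Divisibility being total, this
  suffices for \<open>C \<otimes> E \<longrightarrow> (C + R b) \<otimes> E\<close> to be injective. As a tensor vanishes already over
  finitely many elements, finitely many such steps give injectivity for every extension.
\<close>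

section \<open>Tensor kernels\<close>

lemma tensor_kernel_zero: "0 \<in> tensor_kernel R M N"
  unfolding tensor_kernel_def
  using generate.one[of "free_Abelian_group (carrier M \<times> carrier N)"] by simp

lemma tensor_kernel_add:
  "u \<in> tensor_kernel R M N \<Longrightarrow> v \<in> tensor_kernel R M N \<Longrightarrow> u + v \<in> tensor_kernel R M N"
  unfolding tensor_kernel_def
  using generate.eng[of u "free_Abelian_group (carrier M \<times> carrier N)" _ v] by simp

lemma tensor_kernel_carrier:
  assumes "module R M" "module R N" "u \<in> tensor_kernel R M N"
  shows "u \<in> carrier (free_Abelian_group (carrier M \<times> carrier N))"
  using group.generate_incl[OF group_free_Abelian_group tensor_relators_carrier[OF assms(1,2)]]
    assms(3) unfolding tensor_kernel_def by blast

lemma tensor_kernel_minus: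
  assumes "module R M" "module R N" "u \<in> tensor_kernel R M N"
  shows "- u \<in> tensor_kernel R M N"
  using group.generate_m_inv_closed[OF group_free_Abelian_group
      tensor_relators_carrier[OF assms(1,2)], of u]
    tensor_kernel_carrier[OF assms] assms(3)
  unfolding tensor_kernel_def by simp

lemma tensor_kernel_diff:
  assumes "module R M" "module R N" "u \<in> tensor_kernel R M N" "v \<in> tensor_kernel R M N"
  shows "u - v \<in> tensor_kernel R M N"
  using tensor_kernel_add[OF assms(3) tensor_kernel_minus[OF assms(1,2,4)]] by simp

lemma tensor_kernel_add_left:
  "x \<in> carrier M \<Longrightarrow> x' \<in> carrier M \<Longrightarrow> y \<in> carrier N \<Longrightarrow>
    frag_of (x \<oplus>\<^bsub>M\<^esub> x', y) - frag_of (x, y) - frag_of (x', y) \<in> tensor_kernel R M N"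
  unfolding tensor_kernel_def by (rule generate.incl) (unfold tensor_relators_def, blast)

lemma tensor_kernel_add_right:
  "x \<in> carrier M \<Longrightarrow> y \<in> carrier N \<Longrightarrow> y' \<in> carrier N \<Longrightarrow>
    frag_of (x, y \<oplus>\<^bsub>N\<^esub> y') - frag_of (x, y) - frag_of (x, y') \<in> tensor_kernel R M N"
  unfolding tensor_kernel_def by (rule generate.incl) (unfold tensor_relators_def, blast)

lemma tensor_kernel_smult:
  "r \<in> carrier R \<Longrightarrow> x \<in> carrier M \<Longrightarrow> y \<in> carrier N \<Longrightarrow>
    frag_of (r \<odot>\<^bsub>M\<^esub> x, y) - frag_of (x, r \<odot>\<^bsub>N\<^esub> y) \<in> tensor_kernel R M N"
  unfolding tensor_kernel_def by (rule generate.incl) (unfold tensor_relators_def, blast)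

lemma tensor_kernel_zero_left:
  assumes "module R M" "module R N" "y \<in> carrier N"
  shows "frag_of (\<zero>\<^bsub>M\<^esub>, y) \<in> tensor_kernel R M N"
proof -
  interpret M: module R M by fact
  \<comment> \<open>The additivity relator of \<open>0\<close> and \<open>0\<close> collapses to the
    negative of the generator \<open>(0, y)\<close>.\<close>
  have "- (frag_of (\<zero>\<^bsub>M\<^esub> \<oplus>\<^bsub>M\<^esub> \<zero>\<^bsub>M\<^esub>, y) - frag_of (\<zero>\<^bsub>M\<^esub>, y) - frag_of (\<zero>\<^bsub>M\<^esub>, y)) \<in> tensor_kernel R M N"
    by (intro tensor_kernel_minus tensor_kernel_add_left assms M.zero_closed)
  then show ?thesis by simp
qed

text \<open>The rule replaces \<open>generate\<close> by addition and negation of formal sums and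
  splits the relators into their three families, so that a property is checked on one bilinearity
  relation at a time.\<close>

lemma tensor_kernel_induct [consumes 3, case_names zero add_left add_right smult add minus]:
  assumes "module R M" "module R N" "u \<in> tensor_kernel R M N"
    and "P 0"
    and "\<And>x x' y. x \<in> carrier M \<Longrightarrow> x' \<in> carrier M \<Longrightarrow> y \<in> carrier N \<Longrightarrow>
      P (frag_of (x \<oplus>\<^bsub>M\<^esub> x', y) - frag_of (x, y) - frag_of (x', y))"
    and "\<And>x y y'. x \<in> carrier M \<Longrightarrow> y \<in> carrier N \<Longrightarrow> y' \<in> carrier N \<Longrightarrow>
      P (frag_of (x, y \<oplus>\<^bsub>N\<^esub> y') - frag_of (x, y) - frag_of (x, y'))"
    and "\<And>r x y. r \<in> carrier R \<Longrightarrow> x \<in> carrier M \<Longrightarrow> y \<in> carrier N \<Longrightarrow>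
      P (frag_of (r \<odot>\<^bsub>M\<^esub> x, y) - frag_of (x, r \<odot>\<^bsub>N\<^esub> y))"
    and add: "\<And>u v. P u \<Longrightarrow> P v \<Longrightarrow> P (u + v)"
    and minus: "\<And>u. P u \<Longrightarrow> P (- u)"
  shows "P u"
proof -
  have rel: "P h" if "h \<in> tensor_relators R M N" for h
    using that assms(5-7) unfolding tensor_relators_def by blast
  show ?thesis using assms(3) unfolding tensor_kernel_def
  proof (induction rule: generate.induct)
    case one
    then show ?case using assms(4) by simp
  next
    case (incl h)
    then show ?case by (rule rel)
  next
    case (inv h)
    then have "inv\<^bsub>free_Abelian_group (carrier M \<times> carrier N)\<^esub> h = - h"
      using tensor_relators_carrier[OF assms(1,2)] by auto
    then show ?case using minus[OF rel[OF inv]] by simp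
  next
    case (eng h1 h2)
    then show ?case using add by simp
  qed
qed

text \<open>Functoriality of the tensor product in its first factor, on representatives: a linear
  map turns each relator into a relator of the same family.\<close>

lemma frag_extend_tensor_kernel:
  assumes "module R M" "module R M'" "module R N" "f \<in> module_hom R M M'" "u \<in> tensor_kernel R M N"
  shows "frag_extend (\<lambda>(x, y). frag_of (f x, y)) u \<in> tensor_kernel R M' N"
  using assms(1,3,5)
proof (induction rule: tensor_kernel_induct)
  case zero
  then show ?case by (simp add: tensor_kernel_zero)
next
  case (add_left x x' y)
  then show ?case using module_homD[OF assms(4)]
    by (simp add: frag_extend_diff tensor_kernel_add_left)
next
  case (add_right x y y')
  then show ?case using module_homD[OF assms(4)]
    by (simp add: frag_extend_diff tensor_kernel_add_right)
next
  case (smult r x y)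
  then show ?case using module_homD[OF assms(4)]
    by (simp add: frag_extend_diff tensor_kernel_smult)
next
  case (add u v)
  then show ?case by (simp add: frag_extend_add tensor_kernel_add)
next
  case (minus u)
  then show ?case by (simp add: frag_extend_minus tensor_kernel_minus[OF assms(2,3)])
qed

section \<open>Formal sums under maps of their generators\<close>

lemma frag_extend_id_on:
  assumes "Poly_Mapping.keys u \<subseteq> X" "\<And>p. p \<in> X \<Longrightarrow> g p = frag_of p"
  shows "frag_extend g u = u"
proof -
  have "frag_extend g u = frag_extend frag_of u"
    using assms by (intro frag_extend_eq) auto
  then show ?thesis by (simp flip: frag_expansion)
qed

text \<open>With \<open>g\<close> the inverse of an injective map on its image, this carries a
  tensor over the image back to the source.\<close>

lemma frag_extend_inverse:
  assumes "Poly_Mapping.keys u \<subseteq> X \<times> Y" "\<And>x. x \<in> X \<Longrightarrow> g (f x) = x"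
  shows "frag_extend (\<lambda>(x, y). frag_of (g x, y)) (frag_extend (\<lambda>(x, y). frag_of (f x, y)) u) = u"
proof -
  have "frag_extend (\<lambda>(x, y). frag_of (g x, y)) (frag_extend (\<lambda>(x, y). frag_of (f x, y)) u) =
      frag_extend (\<lambda>(x, y). frag_of (g (f x), y)) u"
    using frag_extend_compose[of "\<lambda>(x, y). frag_of (g x, y)" "\<lambda>(x, y). (f x, y)" u]
    by (simp add: o_def case_prod_unfold)
  also have "\<dots> = u" by (rule frag_extend_id_on[OF assms(1)]) (use assms(2) in auto)
  finally show ?thesis .
qed

text \<open>\<open>tensor_map\<close> is additive on representatives, so its injectivity comes down
  to a trivial kernel, tested on the difference of two representatives. Later arguments can then
  work with formal sums instead of cosets.\<close>

lemma flat_moduleI: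
  fixes R :: "('a, 'b) ring_scheme" and E :: "('a, 'm, 'c) module_scheme"
  assumes E: "module R E"
    and "\<And>(A :: ('a, 't) module) (B :: ('a, 't) module) f u.
      \<lbrakk>module R A; module R B; f \<in> module_hom R A B; inj_on f (carrier A);
       Poly_Mapping.keys u \<subseteq> carrier A \<times> carrier E;
       frag_extend (\<lambda>(x, y). frag_of (f x, y)) u \<in> tensor_kernel R B E\<rbrakk> \<Longrightarrow> u \<in> tensor_kernel R A E"
  shows "flat_module TYPE('t) R E"
  unfolding flat_module_def
proof (intro conjI allI impI, rule E)
  fix A B :: "('a, 't) module" and f
  assume A: "module R A" and B: "module R B" and f: "f \<in> module_hom R A B"
    and inj: "inj_on f (carrier A)"
  let ?FA = "free_Abelian_group (carrier A \<times> carrier E)"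
  let ?FB = "free_Abelian_group (carrier B \<times> carrier E)"
  let ?\<phi> = "frag_extend (\<lambda>(x, y). frag_of (f x, y))"
  interpret KA: normal "tensor_kernel R A E" ?FA by (rule tensor_kernel_normal[OF A E])
  interpret KB: normal "tensor_kernel R B E" ?FB by (rule tensor_kernel_normal[OF B E])
  note tm = tensor_map_coset[OF A B E f]
  show "inj_on (tensor_map R A B E f) (carrier (tensor_product R A E))"
  proof (rule inj_onI)
    fix U V
    assume "U \<in> carrier (tensor_product R A E)" "V \<in> carrier (tensor_product R A E)"
      and eq: "tensor_map R A B E f U = tensor_map R A B E f V"
    then obtain c d where c: "c \<in> carrier ?FA" "U = tensor_kernel R A E #>\<^bsub>?FA\<^esub> c"
      and d: "d \<in> carrier ?FA" "V = tensor_kernel R A E #>\<^bsub>?FA\<^esub> d"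
      by (auto simp: tensor_product_def FactGroup_def RCOSETS_def)
    have "?\<phi> c \<in> tensor_kernel R B E #>\<^bsub>?FB\<^esub> ?\<phi> d"
      using eq c d tm KB.rcos_self[OF tm(1)[OF c(1)] KB.subgroup_axioms] by simp
    then obtain k where k: "k \<in> tensor_kernel R B E" "?\<phi> c = k + ?\<phi> d"
      by (auto simp: r_coset_def)
    then have "?\<phi> (c - d) \<in> tensor_kernel R B E" by (simp add: frag_extend_diff)
    moreover have "Poly_Mapping.keys (c - d) \<subseteq> carrier A \<times> carrier E"
      using c(1) d(1) keys_diff[of c d] by auto
    ultimately have "c - d \<in> tensor_kernel R A E" using assms(2) A B f inj by blast
    then have "c \<in> tensor_kernel R A E #>\<^bsub>?FA\<^esub> d"
      by (auto simp: r_coset_def intro!: bexI[of _ "c - d"])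
    then show "U = V"
      using KA.repr_independence[OF _ d(1) KA.subgroup_axioms] c d by simp
  qed
qed

section \<open>Cyclic extensions\<close>

text \<open>That the annihilator of \<open>s\<close> kills \<open>e\<close> is clearly necessary for
  \<open>e\<close> to be a multiple of \<open>s\<close>; injectivity makes it sufficient, the
  cofactor being the value at \<open>1\<close> of an extended map.\<close>

lemma injective_module_divides:
  fixes R :: "('a, 'b) ring_scheme" and E :: "('a, 'm, 'c) module_scheme"
  assumes inj: "injective_module TYPE('a) R E"
    and s: "s \<in> carrier R" and e: "e \<in> carrier E"
    and ann: "\<And>x. x \<in> carrier R \<Longrightarrow> x \<otimes>\<^bsub>R\<^esub> s = \<zero>\<^bsub>R\<^esub> \<Longrightarrow> x \<odot>\<^bsub>E\<^esub> e = \<zero>\<^bsub>E\<^esub>"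
  shows "\<exists>e'\<in>carrier E. e = s \<odot>\<^bsub>E\<^esub> e'"
proof -
  have E: "module R E" using inj by (simp add: injective_module_def)
  interpret module R E by fact
  let ?I = "PIdl\<^bsub>R\<^esub> s"
  have I: "ideal ?I R" by (rule R.cgenideal_ideal[OF s])
  \<comment> \<open>Some \<open>x\<close> with \<open>p = x s\<close> is chosen. Two choices differ
    by an element of the annihilator of \<open>s\<close>, which kills \<open>e\<close> by
    \<open>ann\<close>, so the value does not depend on the choice.\<close>
  define g where "g p = (SOME x. x \<in> carrier R \<and> p = x \<otimes>\<^bsub>R\<^esub> s) \<odot>\<^bsub>E\<^esub> e" for p
  have g: "g (x \<otimes>\<^bsub>R\<^esub> s) = x \<odot>\<^bsub>E\<^esub> e" if x: "x \<in> carrier R" for x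
  proof -
    define x' where "x' = (SOME z. z \<in> carrier R \<and> x \<otimes>\<^bsub>R\<^esub> s = z \<otimes>\<^bsub>R\<^esub> s)"
    have "x' \<in> carrier R \<and> x \<otimes>\<^bsub>R\<^esub> s = x' \<otimes>\<^bsub>R\<^esub> s"
      unfolding x'_def by (rule someI[of _ x]) (use x in simp)
    then have x': "x' \<in> carrier R" "x \<otimes>\<^bsub>R\<^esub> s = x' \<otimes>\<^bsub>R\<^esub> s" by auto
    have "(x \<ominus>\<^bsub>R\<^esub> x') \<otimes>\<^bsub>R\<^esub> s = \<zero>\<^bsub>R\<^esub>"
      using x x' s by (simp add: a_minus_def R.l_distr R.l_minus R.r_neg)
    then have "(x \<ominus>\<^bsub>R\<^esub> x') \<odot>\<^bsub>E\<^esub> e = \<zero>\<^bsub>E\<^esub>" using ann x x' by simp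
    then have "x \<odot>\<^bsub>E\<^esub> e \<ominus>\<^bsub>E\<^esub> x' \<odot>\<^bsub>E\<^esub> e = \<zero>\<^bsub>E\<^esub>"
      using x x' e by (simp add: a_minus_def smult_l_distr smult_l_minus)
    then have "x \<odot>\<^bsub>E\<^esub> e = x' \<odot>\<^bsub>E\<^esub> e"
      using x x' e M.minus_equality[of "x \<odot>\<^bsub>E\<^esub> e" "\<ominus>\<^bsub>E\<^esub> (x' \<odot>\<^bsub>E\<^esub> e)"]
      by (simp add: a_minus_def)
    then show ?thesis unfolding g_def x'_def[symmetric] by simp
  qed
  have mem: "\<exists>x. x \<in> carrier R \<and> p = x \<otimes>\<^bsub>R\<^esub> s" if "p \<in> ?I" for p
    using that by (auto simp: cgenideal_def)
  have "g \<in> module_hom R (ideal_module R ?I) E"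
  proof (rule module_homI; simp add: ideal_module_def)
    fix p assume "p \<in> ?I"
    then show "g p \<in> carrier E" using mem[of p] g e by auto
    fix q assume "q \<in> ?I"
    then obtain x y where "x \<in> carrier R" "p = x \<otimes>\<^bsub>R\<^esub> s" "y \<in> carrier R" "q = y \<otimes>\<^bsub>R\<^esub> s"
      using mem \<open>p \<in> ?I\<close> by blast
    then show "g (p \<oplus>\<^bsub>R\<^esub> q) = g p \<oplus>\<^bsub>E\<^esub> g q"
      using g[of "x \<oplus>\<^bsub>R\<^esub> y"] s e by (simp add: g R.l_distr smult_l_distr)
  next
    fix r p assume r: "r \<in> carrier R" and "p \<in> ?I"
    then obtain x where "x \<in> carrier R" "p = x \<otimes>\<^bsub>R\<^esub> s" using mem by blast
    then show "g (r \<otimes>\<^bsub>R\<^esub> p) = r \<odot>\<^bsub>E\<^esub> g p"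
      using g[of "r \<otimes>\<^bsub>R\<^esub> x"] r s e by (simp add: g R.m_assoc smult_assoc1)
  qed
  \<comment> \<open>The inclusion of \<open>R s\<close> into the regular module is the embedding
    along which \<open>g\<close> is extended. Both modules consist of ring elements, so they are of
    the test type in \<open>inj\<close>.\<close>
  moreover have "id \<in> module_hom R (ideal_module R ?I) (ideal_module R (carrier R))"
    using ideal.Icarr[OF I] by (intro module_homI) (auto simp: ideal_module_def)
  ultimately obtain h where h: "h \<in> module_hom R (ideal_module R (carrier R)) E"
    and hg: "\<And>x. x \<in> ?I \<Longrightarrow> h x = g x"
    using inj ideal_module[OF R.is_cring I] ideal_module[OF R.is_cring R.oneideal]
    unfolding injective_module_def by (force simp: ideal_module_def)
  have "h (s \<otimes>\<^bsub>R\<^esub> \<one>\<^bsub>R\<^esub>) = s \<odot>\<^bsub>E\<^esub> h \<one>\<^bsub>R\<^esub>" "h \<one>\<^bsub>R\<^esub> \<in> carrier E"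
    using module_homD(3)[OF h, of s "\<one>\<^bsub>R\<^esub>"] module_homD(1)[OF h, of "\<one>\<^bsub>R\<^esub>"] s
    by (auto simp: ideal_module_def)
  moreover have "h s = e" using hg[OF R.cgenideal_self[OF s]] g[of "\<one>\<^bsub>R\<^esub>"] s e by simp
  ultimately show ?thesis using s by auto
qed

section \<open>Adjoining one generator to a submodule\<close>

lemma (in module) module_submodule:
  assumes "submodule C R M"
  shows "module R (M\<lparr>carrier := C\<rparr>)"
  using submodule.submodule_is_module[OF assms module_axioms] .

lemma (in module) submodule_zero:
  assumes "submodule C R M"
  shows "\<zero>\<^bsub>M\<^esub> \<in> C"
  using subgroup.one_closed[OF submodule.axioms(1)[OF assms]] by simp

lemma (in module) submodule_cyclic_extension:
  assumes "submodule C R M" "b \<in> carrier M"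
  defines "D \<equiv> {c \<oplus>\<^bsub>M\<^esub> r \<odot>\<^bsub>M\<^esub> b | c r. c \<in> C \<and> r \<in> carrier R}"
  shows "submodule D R M" "C \<subseteq> D" "b \<in> D"
proof -
  note sm = submoduleE[OF assms(1)]
  have C: "c \<in> carrier M" if "c \<in> C" for c using sm(1) that by blast
  have zC: "\<zero>\<^bsub>M\<^esub> \<in> C" by (rule submodule_zero[OF assms(1)])
  have DI: "c \<oplus>\<^bsub>M\<^esub> r \<odot>\<^bsub>M\<^esub> b \<in> D" if "c \<in> C" "r \<in> carrier R" for c r
    using that unfolding D_def by blast
  show CD: "C \<subseteq> D"
  proof
    fix c assume "c \<in> C"
    then show "c \<in> D" using DI[of c "\<zero>\<^bsub>R\<^esub>"] C assms(2) by simp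
  qed
  show "b \<in> D" using DI[OF zC, of "\<one>\<^bsub>R\<^esub>"] assms(2) by simp
  show "submodule D R M"
  proof (rule submoduleI)
    show "D \<subseteq> carrier M" unfolding D_def using C assms(2) by auto
    show "\<zero>\<^bsub>M\<^esub> \<in> D" using zC CD by blast
    fix x assume "x \<in> D"
    then obtain c r where x: "c \<in> C" "r \<in> carrier R" "x = c \<oplus>\<^bsub>M\<^esub> r \<odot>\<^bsub>M\<^esub> b"
      unfolding D_def by blast
    have "\<ominus>\<^bsub>M\<^esub> x = \<ominus>\<^bsub>M\<^esub> c \<oplus>\<^bsub>M\<^esub> (\<ominus>\<^bsub>R\<^esub> r) \<odot>\<^bsub>M\<^esub> b"
      using x C assms(2) by (simp add: M.minus_add smult_l_minus)
    then show "\<ominus>\<^bsub>M\<^esub> x \<in> D" using DI[OF sm(3)[OF x(1)], of "\<ominus>\<^bsub>R\<^esub> r"] x by simp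
    fix y assume "y \<in> D"
    then obtain c' r' where y: "c' \<in> C" "r' \<in> carrier R" "y = c' \<oplus>\<^bsub>M\<^esub> r' \<odot>\<^bsub>M\<^esub> b"
      unfolding D_def by blast
    have "x \<oplus>\<^bsub>M\<^esub> y = (c \<oplus>\<^bsub>M\<^esub> c') \<oplus>\<^bsub>M\<^esub> (r \<oplus>\<^bsub>R\<^esub> r') \<odot>\<^bsub>M\<^esub> b"
      using x y C assms(2) by (simp add: smult_l_distr M.a_ac)
    then show "x \<oplus>\<^bsub>M\<^esub> y \<in> D" using DI[OF sm(5)[OF x(1) y(1)]] x y by simp
  next
    fix t x assume t: "t \<in> carrier R" and "x \<in> D"
    then obtain c r where x: "c \<in> C" "r \<in> carrier R" "x = c \<oplus>\<^bsub>M\<^esub> r \<odot>\<^bsub>M\<^esub> b"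
      unfolding D_def by blast
    have "t \<odot>\<^bsub>M\<^esub> x = t \<odot>\<^bsub>M\<^esub> c \<oplus>\<^bsub>M\<^esub> (t \<otimes>\<^bsub>R\<^esub> r) \<odot>\<^bsub>M\<^esub> b"
      using x t C assms(2) by (simp add: smult_r_distr smult_assoc1)
    then show "t \<odot>\<^bsub>M\<^esub> x \<in> D" using DI[OF sm(4)[OF t x(1)]] x t by simp
  qed
qed

text \<open>A tensor over \<open>C\<close> that vanishes over \<open>D\<close> has the form
  \<open>- r b \<otimes> e\<close> with \<open>r b \<in> C\<close> and \<open>r e = 0\<close>, as a
  presentation of \<open>D \<otimes> E\<close> shows. Then \<open>torsion\<close> gives
  \<open>e = s e'\<close> with \<open>s r = 0\<close>, and
  \<open>r b \<otimes> e = s r b \<otimes> e' = 0\<close> holds already over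
  \<open>C\<close>.\<close>

lemma tensor_kernel_cyclic_extension:
  fixes R :: "('a, 'b) ring_scheme" and E :: "('a, 'm, 'c) module_scheme"
    and B :: "('a, 'n, 'd) module_scheme"
  assumes E: "module R E" and B: "module R B" and C: "submodule C R B" and b: "b \<in> carrier B"
    and chain: "\<And>x y. x \<in> carrier R \<Longrightarrow> y \<in> carrier R \<Longrightarrow>
      (\<exists>c\<in>carrier R. x = c \<otimes>\<^bsub>R\<^esub> y) \<or> (\<exists>c\<in>carrier R. y = c \<otimes>\<^bsub>R\<^esub> x)"
    and torsion: "\<And>r e. r \<in> carrier R \<Longrightarrow> e \<in> carrier E \<Longrightarrow> r \<odot>\<^bsub>E\<^esub> e = \<zero>\<^bsub>E\<^esub> \<Longrightarrow>
      \<exists>s\<in>carrier R. \<exists>e'\<in>carrier E. s \<otimes>\<^bsub>R\<^esub> r = \<zero>\<^bsub>R\<^esub> \<and> e = s \<odot>\<^bsub>E\<^esub> e'"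
  defines "D \<equiv> {c \<oplus>\<^bsub>B\<^esub> r \<odot>\<^bsub>B\<^esub> b | c r. c \<in> C \<and> r \<in> carrier R}"
  assumes u: "u \<in> tensor_kernel R (B\<lparr>carrier := D\<rparr>) E"
    and keys: "Poly_Mapping.keys u \<subseteq> C \<times> carrier E"
  shows "u \<in> tensor_kernel R (B\<lparr>carrier := C\<rparr>) E"
proof -
  interpret E: module R E by fact
  interpret B: module R B by fact
  let ?K = "tensor_kernel R (B\<lparr>carrier := C\<rparr>) E"
  have D: "submodule D R B" "C \<subseteq> D"
    unfolding D_def by (intro B.submodule_cyclic_extension C b)+
  note CE = B.submoduleE[OF C] and DE = B.submoduleE[OF D(1)]
  have CB: "c \<in> carrier B" if "c \<in> C" for c using CE(1) that by blast
  note MC = B.module_submodule[OF C] and MD = B.module_submodule[OF D(1)]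
  have K0: "0 \<in> ?K" and Ka: "\<And>v w. v \<in> ?K \<Longrightarrow> w \<in> ?K \<Longrightarrow> v + w \<in> ?K"
    and Kd: "\<And>v w. v \<in> ?K \<Longrightarrow> w \<in> ?K \<Longrightarrow> v - w \<in> ?K" and Km: "\<And>v. v \<in> ?K \<Longrightarrow> - v \<in> ?K"
    by (auto intro: tensor_kernel_zero tensor_kernel_add tensor_kernel_diff tensor_kernel_minus MC E)
  have Kl: "frag_of (x \<oplus>\<^bsub>B\<^esub> x', y) - frag_of (x, y) - frag_of (x', y) \<in> ?K"
    if "x \<in> C" "x' \<in> C" "y \<in> carrier E" for x x' y
    using tensor_kernel_add_left[of x "B\<lparr>carrier := C\<rparr>" x' y] that by simp
  have Kr: "frag_of (x, y \<oplus>\<^bsub>E\<^esub> y') - frag_of (x, y) - frag_of (x, y') \<in> ?K"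
    if "x \<in> C" "y \<in> carrier E" "y' \<in> carrier E" for x y y'
    using tensor_kernel_add_right[of x "B\<lparr>carrier := C\<rparr>" y E y'] that by simp
  have Ks: "frag_of (t \<odot>\<^bsub>B\<^esub> x, y) - frag_of (x, t \<odot>\<^bsub>E\<^esub> y) \<in> ?K"
    if "t \<in> carrier R" "x \<in> C" "y \<in> carrier E" for t x y
    using tensor_kernel_smult[of t R x "B\<lparr>carrier := C\<rparr>" y] that by simp
  have Kz: "frag_of (\<zero>\<^bsub>B\<^esub>, y) \<in> ?K" if "y \<in> carrier E" for y
    using tensor_kernel_zero_left[OF MC E that] by simp

  \<comment> \<open>\<open>I\<close> holds the coefficients that make the form
    \<open>c + r b\<close> ambiguous, since \<open>r b\<close> can then be absorbed into
    \<open>C\<close>.\<close>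
  define I where "I = {r \<in> carrier R. r \<odot>\<^bsub>B\<^esub> b \<in> C}"
  have IR: "r \<in> carrier R" "r \<odot>\<^bsub>B\<^esub> b \<in> C" if "r \<in> I" for r using that by (auto simp: I_def)
  \<comment> \<open>The tensor product of \<open>D\<close> and \<open>E\<close> is the quotient of \<open>C \<otimes> E \<oplus> E\<close> by the subgroup
    spanned by the pairs \<open>(- r b \<otimes> e, r e)\<close> with \<open>r \<in> I\<close>; \<open>L v m\<close> says that \<open>(v, m)\<close> represents
    such a pair, and totality of divisibility makes these pairs already a subgroup.\<close>
  define L where "L v m \<longleftrightarrow> (\<exists>r\<in>I. \<exists>e\<in>carrier E. v + frag_of (r \<odot>\<^bsub>B\<^esub> b, e) \<in> ?K \<and> m = r \<odot>\<^bsub>E\<^esub> e)"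
    for v m
  have L_ker: "L v \<zero>\<^bsub>E\<^esub>" if "v \<in> ?K" for v
    unfolding L_def I_def using Ka[OF that Kz[of "\<zero>\<^bsub>E\<^esub>"]] b B.submodule_zero[OF C]
    by (intro bexI[of _ "\<zero>\<^bsub>R\<^esub>"] bexI[of _ "\<zero>\<^bsub>E\<^esub>"]) auto
  have L_minus: "L (- v) (\<ominus>\<^bsub>E\<^esub> m)" if vm: "L v m" for v m
  proof -
    obtain r e where r: "r \<in> I" "e \<in> carrier E" "v + frag_of (r \<odot>\<^bsub>B\<^esub> b, e) \<in> ?K" "m = r \<odot>\<^bsub>E\<^esub> e"
      using vm unfolding L_def by blast
    \<comment> \<open>The additivity relator of \<open>0\<close> and \<open>0\<close> in the right
      entry yields \<open>r b \<otimes> 0 = 0\<close>; with the relator of \<open>e\<close> and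
      \<open>- e\<close> this turns a pair for \<open>e\<close> into one for
      \<open>- e\<close>.\<close>
    have "frag_of (r \<odot>\<^bsub>B\<^esub> b, \<zero>\<^bsub>E\<^esub>) \<in> ?K"
      using Km[OF Kr[of "r \<odot>\<^bsub>B\<^esub> b" "\<zero>\<^bsub>E\<^esub>" "\<zero>\<^bsub>E\<^esub>"]] IR[OF r(1)] by simp
    from Kd[OF this Ka[OF Kr[of "r \<odot>\<^bsub>B\<^esub> b" e "\<ominus>\<^bsub>E\<^esub> e"] r(3)]]
    have "- v + frag_of (r \<odot>\<^bsub>B\<^esub> b, \<ominus>\<^bsub>E\<^esub> e) \<in> ?K"
      using r IR[OF r(1)] by (simp add: E.M.r_neg algebra_simps)
    moreover have "\<ominus>\<^bsub>E\<^esub> m = r \<odot>\<^bsub>E\<^esub> (\<ominus>\<^bsub>E\<^esub> e)" using r IR[OF r(1)] by (simp add: E.smult_r_minus)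
    ultimately show ?thesis unfolding L_def using r(1,2) by blast
  qed
  \<comment> \<open>If \<open>r' = c r\<close>, the scalar \<open>c\<close> crosses the tensor sign:
    \<open>r' b \<otimes> e' = r b \<otimes> c e'\<close> and \<open>r' e' = r (c e')\<close>. Both
    pairs then have coefficient \<open>r\<close>, and their sum is the pair of \<open>r\<close> and
    \<open>e + c e'\<close>.\<close>
  have L_add_dvd: "L (v + v') (r \<odot>\<^bsub>E\<^esub> e \<oplus>\<^bsub>E\<^esub> r' \<odot>\<^bsub>E\<^esub> e')"
    if r: "r \<in> I" "e \<in> carrier E" "v + frag_of (r \<odot>\<^bsub>B\<^esub> b, e) \<in> ?K"
      and r': "r' \<in> I" "e' \<in> carrier E" "v' + frag_of (r' \<odot>\<^bsub>B\<^esub> b, e') \<in> ?K"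
      and c: "c \<in> carrier R" "r' = c \<otimes>\<^bsub>R\<^esub> r" for v v' r e r' e' c
  proof -
    have r'b: "r' \<odot>\<^bsub>B\<^esub> b = c \<odot>\<^bsub>B\<^esub> (r \<odot>\<^bsub>B\<^esub> b)"
      using c IR[OF r(1)] b by (simp add: B.smult_assoc1)
    have "(v + v') + frag_of (r \<odot>\<^bsub>B\<^esub> b, e \<oplus>\<^bsub>E\<^esub> c \<odot>\<^bsub>E\<^esub> e') =
        (v + frag_of (r \<odot>\<^bsub>B\<^esub> b, e)) + (v' + frag_of (r' \<odot>\<^bsub>B\<^esub> b, e'))
        + (frag_of (r \<odot>\<^bsub>B\<^esub> b, e \<oplus>\<^bsub>E\<^esub> c \<odot>\<^bsub>E\<^esub> e') - frag_of (r \<odot>\<^bsub>B\<^esub> b, e) - frag_of (r \<odot>\<^bsub>B\<^esub> b, c \<odot>\<^bsub>E\<^esub> e'))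
        - (frag_of (c \<odot>\<^bsub>B\<^esub> (r \<odot>\<^bsub>B\<^esub> b), e') - frag_of (r \<odot>\<^bsub>B\<^esub> b, c \<odot>\<^bsub>E\<^esub> e'))"
      by (simp add: r'b)
    also have "\<dots> \<in> ?K"
      by (rule Kd[OF Ka[OF Ka[OF r(3) r'(3)] Kr] Ks]) (use r r' c IR in auto)
    finally have "(v + v') + frag_of (r \<odot>\<^bsub>B\<^esub> b, e \<oplus>\<^bsub>E\<^esub> c \<odot>\<^bsub>E\<^esub> e') \<in> ?K" .
    moreover have "r \<odot>\<^bsub>E\<^esub> e \<oplus>\<^bsub>E\<^esub> r' \<odot>\<^bsub>E\<^esub> e' = r \<odot>\<^bsub>E\<^esub> (e \<oplus>\<^bsub>E\<^esub> c \<odot>\<^bsub>E\<^esub> e')"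
      using r r' c IR by (simp add: E.smult_r_distr E.R.m_comm flip: E.smult_assoc1)
    ultimately show ?thesis unfolding L_def using r r' c by blast
  qed
  have L_add: "L (v + v') (m \<oplus>\<^bsub>E\<^esub> m')" if vm: "L v m" "L v' m'" for v v' m m'
  proof -
    obtain r e where r: "r \<in> I" "e \<in> carrier E" "v + frag_of (r \<odot>\<^bsub>B\<^esub> b, e) \<in> ?K" "m = r \<odot>\<^bsub>E\<^esub> e"
      using vm(1) unfolding L_def by blast
    obtain r' e' where r': "r' \<in> I" "e' \<in> carrier E" "v' + frag_of (r' \<odot>\<^bsub>B\<^esub> b, e') \<in> ?K" "m' = r' \<odot>\<^bsub>E\<^esub> e'"
      using vm(2) unfolding L_def by blast
    consider c where "c \<in> carrier R" "r' = c \<otimes>\<^bsub>R\<^esub> r" | c where "c \<in> carrier R" "r = c \<otimes>\<^bsub>R\<^esub> r'"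
      using chain[OF IR(1)[OF r(1)] IR(1)[OF r'(1)]] by blast
    then show ?thesis
    proof cases
      case 1
      then show ?thesis using L_add_dvd[OF r(1-3) r'(1-3)] r(4) r'(4) by simp
    next
      case 2
      then have "L (v' + v) (m' \<oplus>\<^bsub>E\<^esub> m)" using L_add_dvd[OF r'(1-3) r(1-3)] r(4) r'(4) by simp
      moreover have "m' \<oplus>\<^bsub>E\<^esub> m = m \<oplus>\<^bsub>E\<^esub> m'"
        using r r' IR by (intro E.M.a_comm) auto
      ultimately show ?thesis by (simp add: add.commute)
    qed
  qed

  \<comment> \<open>Each element of \<open>D\<close> gets one decomposition \<open>c + r b\<close>.
    On \<open>C\<close> it is fixed as \<open>x + 0 b\<close>, so that a formal sum with left
    entries in \<open>C\<close> will be left unchanged; outside \<open>D\<close> the value is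
    arbitrary.\<close>
  have "\<exists>q. (x \<in> D \<longrightarrow> fst q \<in> C \<and> snd q \<in> carrier R \<and> x = fst q \<oplus>\<^bsub>B\<^esub> snd q \<odot>\<^bsub>B\<^esub> b) \<and>
      (x \<in> C \<longrightarrow> q = (x, \<zero>\<^bsub>R\<^esub>))" for x
  proof (cases "x \<in> C")
    case True
    then show ?thesis using CB b by (intro exI[of _ "(x, \<zero>\<^bsub>R\<^esub>)"]) simp
  next
    case False
    then show ?thesis unfolding D_def by fastforce
  qed
  then obtain q where q: "\<And>x. x \<in> D \<Longrightarrow> fst (q x) \<in> C" "\<And>x. x \<in> D \<Longrightarrow> snd (q x) \<in> carrier R"
      "\<And>x. x \<in> D \<Longrightarrow> x = fst (q x) \<oplus>\<^bsub>B\<^esub> snd (q x) \<odot>\<^bsub>B\<^esub> b"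
    and qC: "\<And>x. x \<in> C \<Longrightarrow> q x = (x, \<zero>\<^bsub>R\<^esub>)"
    by metis
  define \<gamma> where "\<gamma> x = fst (q x)" for x
  define \<rho> where "\<rho> x = snd (q x)" for x
  have \<gamma>: "\<gamma> x \<in> C" and \<gamma>B: "\<gamma> x \<in> carrier B" and \<rho>: "\<rho> x \<in> carrier R"
    and dec: "x = \<gamma> x \<oplus>\<^bsub>B\<^esub> \<rho> x \<odot>\<^bsub>B\<^esub> b" if "x \<in> D" for x
    using q that CB by (simp_all add: \<gamma>_def \<rho>_def)
  have \<gamma>C: "\<gamma> x = x" and \<rho>C: "\<rho> x = \<zero>\<^bsub>R\<^esub>" if "x \<in> C" for x
    using qC that by (simp_all add: \<gamma>_def \<rho>_def)
  \<comment> \<open>\<open>?\<phi>\<close> and \<open>\<psi>\<close> are the components of the map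
    sending \<open>x \<otimes> y\<close> to \<open>(\<gamma> x \<otimes> y, \<rho> x y)\<close> in
    \<open>C \<otimes> E \<oplus> E\<close>. The first stays among formal sums; the second lands in
    \<open>E\<close> itself and comes from the universal property of the free abelian group.\<close>
  let ?F = "free_Abelian_group (D \<times> carrier E)"
  let ?\<phi> = "frag_extend (\<lambda>(x, y). frag_of (\<gamma> x, y))"
  have "comm_group (add_monoid E)" by (rule E.M.a_comm_group)
  moreover have "(\<lambda>(x, y). \<rho> x \<odot>\<^bsub>E\<^esub> y) ` (D \<times> carrier E) \<subseteq> carrier (add_monoid E)"
    using \<rho> by auto
  ultimately obtain \<psi> where \<psi>: "\<psi> \<in> hom ?F (add_monoid E)"
    and \<psi>_of': "\<And>p. p \<in> D \<times> carrier E \<Longrightarrow> \<psi> (frag_of p) = (case p of (x, y) \<Rightarrow> \<rho> x \<odot>\<^bsub>E\<^esub> y)"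
    by (rule comm_group.free_Abelian_group_universal) blast
  have \<psi>_of: "\<psi> (frag_of (x, y)) = \<rho> x \<odot>\<^bsub>E\<^esub> y" if "x \<in> D" "y \<in> carrier E" for x y
    using \<psi>_of' that by simp
  interpret \<psi>: group_hom ?F "add_monoid E" \<psi>
    using \<psi> E.M.a_group by (simp add: group_hom_def group_hom_axioms_def)
  \<comment> \<open>\<open>\<psi>\<close> is specified only on the carrier of \<open>?F\<close>, so
    membership in \<open>X\<close> has to travel with the induction below.\<close>
  define X where "X = {v :: ('n \<times> 'm) \<Rightarrow>\<^sub>0 int. Poly_Mapping.keys v \<subseteq> D \<times> carrier E}"
  have \<psi>_add: "\<psi> (v + w) = \<psi> v \<oplus>\<^bsub>E\<^esub> \<psi> w" if "v \<in> X" "w \<in> X" for v w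
    using \<psi>.hom_mult[of v w] that by (simp add: X_def)
  have \<psi>_minus: "\<psi> (- v) = \<ominus>\<^bsub>E\<^esub> \<psi> v" if "v \<in> X" for v
    using \<psi>.hom_inv[of v] that by (simp add: X_def a_inv_def)
  have \<psi>_cl: "\<psi> v \<in> carrier E" if "v \<in> X" for v
    using \<psi>.hom_closed[of v] that by (simp add: X_def)
  have X_minus: "- v \<in> X" if "v \<in> X" for v using that by (simp add: X_def)
  have X_add: "v + w \<in> X" if "v \<in> X" "w \<in> X" for v w using that keys_add[of v w] by (auto simp: X_def)
  have X_diff: "v - w \<in> X" if "v \<in> X" "w \<in> X" for v w using that keys_diff[of v w] by (auto simp: X_def)
  have X_of: "frag_of (x, y) \<in> X" if "x \<in> D" "y \<in> carrier E" for x y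
    using that by (simp add: X_def)
  have \<psi>_diff: "\<psi> (v - w) = \<psi> v \<oplus>\<^bsub>E\<^esub> \<ominus>\<^bsub>E\<^esub> \<psi> w" if "v \<in> X" "w \<in> X" for v w
    using \<psi>_add[OF that(1) X_minus[OF that(2)]] \<psi>_minus[OF that(2)] by simp
  have cancel: "p \<oplus>\<^bsub>B\<^esub> r \<odot>\<^bsub>B\<^esub> b = w"
    if "p \<in> carrier B" "w \<in> carrier B" "s \<in> carrier R" "r \<in> carrier R"
      "p \<oplus>\<^bsub>B\<^esub> (r \<oplus>\<^bsub>R\<^esub> s) \<odot>\<^bsub>B\<^esub> b = w \<oplus>\<^bsub>B\<^esub> s \<odot>\<^bsub>B\<^esub> b" for p w r s
  proof -
    have "(p \<oplus>\<^bsub>B\<^esub> r \<odot>\<^bsub>B\<^esub> b) \<oplus>\<^bsub>B\<^esub> s \<odot>\<^bsub>B\<^esub> b = w \<oplus>\<^bsub>B\<^esub> s \<odot>\<^bsub>B\<^esub> b"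
      using that b by (simp add: B.smult_l_distr B.M.a_assoc)
    then show ?thesis using that b by simp
  qed
  \<comment> \<open>Two elements of \<open>C\<close> that differ by \<open>r b\<close> force
    \<open>r \<in> I\<close>, and their difference splits off over \<open>C\<close> as the tensor
    \<open>r b \<otimes> y\<close>.\<close>
  have shift: "r \<in> I" "frag_of (p \<oplus>\<^bsub>B\<^esub> r \<odot>\<^bsub>B\<^esub> b, y) - frag_of (p, y) - frag_of (r \<odot>\<^bsub>B\<^esub> b, y) \<in> ?K"
    if "p \<in> C" "w \<in> C" "r \<in> carrier R" "y \<in> carrier E" "p \<oplus>\<^bsub>B\<^esub> r \<odot>\<^bsub>B\<^esub> b = w" for p w r y
  proof -
    have "r \<odot>\<^bsub>B\<^esub> b = \<ominus>\<^bsub>B\<^esub> p \<oplus>\<^bsub>B\<^esub> w"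
      using that b CB by (metis B.M.r_neg1 B.smult_closed)
    then have "r \<odot>\<^bsub>B\<^esub> b \<in> C" using that CE(3,5) by simp
    then show "r \<in> I" "frag_of (p \<oplus>\<^bsub>B\<^esub> r \<odot>\<^bsub>B\<^esub> b, y) - frag_of (p, y) - frag_of (r \<odot>\<^bsub>B\<^esub> b, y) \<in> ?K"
      using that Kl by (auto simp: I_def)
  qed
  \<comment> \<open>\<open>\<gamma>\<close> and \<open>\<rho>\<close> need not be linear, so a
    relator of \<open>D \<otimes> E\<close> need not go to zero. It does go to a pair described by
    \<open>L\<close>, because the failure of linearity has its coefficient in
    \<open>I\<close>.\<close>
  have "u \<in> X \<and> L (?\<phi> u) (\<psi> u)"
    using MD E u
  proof (induction rule: tensor_kernel_induct)
    case zero
    have "\<psi> 0 = \<zero>\<^bsub>E\<^esub>" using \<psi>.hom_one by simp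
    then show ?case using L_ker[OF K0] by (simp add: X_def)
  next
    case (add_left x x' y)
    then have xD: "x \<in> D" "x' \<in> D" "x \<oplus>\<^bsub>B\<^esub> x' \<in> D" and y: "y \<in> carrier E" using DE(5) by auto
    let ?p = "\<gamma> (x \<oplus>\<^bsub>B\<^esub> x')"
    \<comment> \<open>\<open>r\<close> is the failure of \<open>\<rho>\<close> to be additive. By
      \<open>pr\<close> the element \<open>r b\<close> makes up for the failure of
      \<open>\<gamma>\<close>, so the relator goes to the pair
      \<open>(- r b \<otimes> y, r y)\<close>.\<close>
    define r where "r = \<rho> (x \<oplus>\<^bsub>B\<^esub> x') \<oplus>\<^bsub>R\<^esub> \<ominus>\<^bsub>R\<^esub> (\<rho> x \<oplus>\<^bsub>R\<^esub> \<rho> x')"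
    note cl = xD[THEN \<gamma>] xD[THEN \<gamma>B] xD[THEN \<rho>]
    have r: "r \<in> carrier R" "r \<oplus>\<^bsub>R\<^esub> (\<rho> x \<oplus>\<^bsub>R\<^esub> \<rho> x') = \<rho> (x \<oplus>\<^bsub>B\<^esub> x')"
      unfolding r_def using cl by (auto simp: E.R.a_assoc E.R.l_neg)
    have "?p \<oplus>\<^bsub>B\<^esub> \<rho> (x \<oplus>\<^bsub>B\<^esub> x') \<odot>\<^bsub>B\<^esub> b = (\<gamma> x \<oplus>\<^bsub>B\<^esub> \<rho> x \<odot>\<^bsub>B\<^esub> b) \<oplus>\<^bsub>B\<^esub> (\<gamma> x' \<oplus>\<^bsub>B\<^esub> \<rho> x' \<odot>\<^bsub>B\<^esub> b)"
      using dec xD by metis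
    also have "\<dots> = (\<gamma> x \<oplus>\<^bsub>B\<^esub> \<gamma> x') \<oplus>\<^bsub>B\<^esub> (\<rho> x \<oplus>\<^bsub>R\<^esub> \<rho> x') \<odot>\<^bsub>B\<^esub> b"
      using cl b by (simp add: B.smult_l_distr B.M.a_ac)
    finally have pr: "?p \<oplus>\<^bsub>B\<^esub> r \<odot>\<^bsub>B\<^esub> b = \<gamma> x \<oplus>\<^bsub>B\<^esub> \<gamma> x'"
      using cancel[of ?p _ "\<rho> x \<oplus>\<^bsub>R\<^esub> \<rho> x'" r] cl r by simp
    note sh = shift[OF cl(3) CE(5)[OF cl(1,2)] r(1) y pr]
    have "?\<phi> (frag_of (x \<oplus>\<^bsub>B\<^esub> x', y) - frag_of (x, y) - frag_of (x', y)) + frag_of (r \<odot>\<^bsub>B\<^esub> b, y) \<in> ?K"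
      using Kd[OF Kl[OF cl(1,2) y] sh(2)] pr
      by (simp add: frag_extend_diff frag_extend_add algebra_simps)
    moreover have "\<psi> (frag_of (x \<oplus>\<^bsub>B\<^esub> x', y) - frag_of (x, y) - frag_of (x', y)) = r \<odot>\<^bsub>E\<^esub> y"
      unfolding r_def using xD y cl
      by (simp add: \<psi>_diff X_diff X_of \<psi>_of E.smult_l_distr E.smult_l_minus E.M.minus_add E.M.a_assoc)
    moreover have "frag_of (x \<oplus>\<^bsub>B\<^esub> x', y) - frag_of (x, y) - frag_of (x', y) \<in> X"
      using xD y by (intro X_diff X_of)
    ultimately show ?case using sh(1) y unfolding L_def by auto
  next
    case (add_right x y y')
    then have x: "x \<in> D" by simp
    \<comment> \<open>The left entry is the same in all three terms, so only one decomposition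
      occurs and the relator goes to zero in both components.\<close>
    have "?\<phi> (frag_of (x, y \<oplus>\<^bsub>E\<^esub> y') - frag_of (x, y) - frag_of (x, y')) \<in> ?K"
      using Kr[OF \<gamma>[OF x]] add_right by (simp add: frag_extend_diff)
    moreover have "\<psi> (frag_of (x, y \<oplus>\<^bsub>E\<^esub> y') - frag_of (x, y) - frag_of (x, y')) = \<zero>\<^bsub>E\<^esub>"
      using x \<rho>[OF x] add_right(2,3)
      by (simp add: \<psi>_diff X_diff X_of \<psi>_of E.smult_r_distr E.M.a_ac E.M.r_neg E.M.r_neg1 E.M.r_neg2)
    moreover have "frag_of (x, y \<oplus>\<^bsub>E\<^esub> y') - frag_of (x, y) - frag_of (x, y') \<in> X"
      using x add_right by (intro X_diff X_of) auto
    ultimately show ?case using L_ker by simp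
  next
    case (smult t x y)
    then have xD: "x \<in> D" "t \<odot>\<^bsub>B\<^esub> x \<in> D" and t: "t \<in> carrier R" and y: "y \<in> carrier E"
      using DE(4) by auto
    let ?p = "\<gamma> (t \<odot>\<^bsub>B\<^esub> x)"
    \<comment> \<open>As for sums, with the failure of \<open>\<rho>\<close> to commute with the
      scalar \<open>t\<close>.\<close>
    define r where "r = \<rho> (t \<odot>\<^bsub>B\<^esub> x) \<oplus>\<^bsub>R\<^esub> \<ominus>\<^bsub>R\<^esub> (t \<otimes>\<^bsub>R\<^esub> \<rho> x)"
    note cl = xD[THEN \<gamma>] xD[THEN \<gamma>B] xD[THEN \<rho>]
    have r: "r \<in> carrier R" "r \<oplus>\<^bsub>R\<^esub> (t \<otimes>\<^bsub>R\<^esub> \<rho> x) = \<rho> (t \<odot>\<^bsub>B\<^esub> x)"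
      unfolding r_def using cl t by (auto simp: E.R.a_assoc E.R.l_neg)
    have "?p \<oplus>\<^bsub>B\<^esub> \<rho> (t \<odot>\<^bsub>B\<^esub> x) \<odot>\<^bsub>B\<^esub> b = t \<odot>\<^bsub>B\<^esub> (\<gamma> x \<oplus>\<^bsub>B\<^esub> \<rho> x \<odot>\<^bsub>B\<^esub> b)"
      using dec xD by metis
    also have "\<dots> = t \<odot>\<^bsub>B\<^esub> \<gamma> x \<oplus>\<^bsub>B\<^esub> (t \<otimes>\<^bsub>R\<^esub> \<rho> x) \<odot>\<^bsub>B\<^esub> b"
      using cl t b by (simp add: B.smult_r_distr B.smult_assoc1)
    finally have pr: "?p \<oplus>\<^bsub>B\<^esub> r \<odot>\<^bsub>B\<^esub> b = t \<odot>\<^bsub>B\<^esub> \<gamma> x"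
      using cancel[of ?p _ "t \<otimes>\<^bsub>R\<^esub> \<rho> x" r] cl r t by simp
    note sh = shift[OF cl(2) CE(4)[OF t cl(1)] r(1) y pr]
    have "?\<phi> (frag_of (t \<odot>\<^bsub>B\<^esub> x, y) - frag_of (x, t \<odot>\<^bsub>E\<^esub> y)) + frag_of (r \<odot>\<^bsub>B\<^esub> b, y) \<in> ?K"
      using Kd[OF Ks[OF t cl(1) y] sh(2)] pr
      by (simp add: frag_extend_diff frag_extend_add algebra_simps)
    moreover have "\<psi> (frag_of (t \<odot>\<^bsub>B\<^esub> x, y) - frag_of (x, t \<odot>\<^bsub>E\<^esub> y)) = r \<odot>\<^bsub>E\<^esub> y"
      unfolding r_def using xD y t cl
      by (simp add: \<psi>_diff X_of \<psi>_of E.smult_l_distr E.smult_l_minus E.R.m_comm[of t] E.smult_assoc1)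
    moreover have "frag_of (t \<odot>\<^bsub>B\<^esub> x, y) - frag_of (x, t \<odot>\<^bsub>E\<^esub> y) \<in> X"
      using xD y t by (intro X_diff X_of) auto
    ultimately show ?case using sh(1) y unfolding L_def by auto
  next
    case (add v w)
    then show ?case using L_add \<psi>_add X_add by (simp add: frag_extend_add)
  next
    case (minus v)
    then show ?case using L_minus \<psi>_minus X_minus by (simp add: frag_extend_minus)
  qed
  \<comment> \<open>The left entries of \<open>u\<close> lie in \<open>C\<close>, where the chosen
    coefficient is \<open>0\<close>. Hence \<open>?\<phi> u = u\<close> and
    \<open>\<psi> u = 0\<close>, and \<open>L\<close> leaves \<open>u = - r b \<otimes> e\<close>
    with \<open>r e = 0\<close>.\<close>
  moreover have "?\<phi> u = u" by (rule frag_extend_id_on[OF keys]) (auto simp: \<gamma>C)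
  moreover have "u \<in> X \<and> \<psi> u = \<zero>\<^bsub>E\<^esub>"
    using keys
  proof (induction u rule: frag_induction)
    case zero
    show ?case using \<psi>.hom_one by (simp add: X_def)
  next
    case (one p)
    then show ?case using \<psi>_of[of "fst p" "snd p"] X_of[of "fst p" "snd p"] D(2) \<rho>C by (cases p) auto
  next
    case (diff v w)
    then show ?case using \<psi>_diff[of v w] X_diff[of v w] by (simp add: E.M.r_neg)
  qed
  ultimately obtain r e where r: "r \<in> I" "e \<in> carrier E" "u + frag_of (r \<odot>\<^bsub>B\<^esub> b, e) \<in> ?K"
      "r \<odot>\<^bsub>E\<^esub> e = \<zero>\<^bsub>E\<^esub>"
    unfolding L_def by metis
  obtain s e' where s: "s \<in> carrier R" "e' \<in> carrier E" "s \<otimes>\<^bsub>R\<^esub> r = \<zero>\<^bsub>R\<^esub>" "e = s \<odot>\<^bsub>E\<^esub> e'"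
    using torsion[OF IR(1)[OF r(1)] r(2,4)] by blast
  \<comment> \<open>It is \<open>r b\<close>, not \<open>b\<close>, that is known to lie in
    \<open>C\<close>; so \<open>s\<close> is moved across the tensor sign onto
    \<open>r b\<close>.\<close>
  have "s \<odot>\<^bsub>B\<^esub> (r \<odot>\<^bsub>B\<^esub> b) = \<zero>\<^bsub>B\<^esub>"
    using s IR[OF r(1)] b by (simp flip: B.smult_assoc1)
  then have "frag_of (r \<odot>\<^bsub>B\<^esub> b, e) \<in> ?K"
    using Kd[OF Kz[OF s(2)] Ks[OF s(1) IR(2)[OF r(1)] s(2)]] s(4) by simp
  from Kd[OF r(3) this] show ?thesis by simp
qed

section \<open>Flatness of injective modules\<close>

text \<open>Membership in the kernel is witnessed by finitely many relators. \<open>F\<close>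
  collects the elements of \<open>B\<close> from which their left entries are built, and a submodule
  containing \<open>F\<close> admits the same relators.\<close>

lemma tensor_kernel_finitely_generated:
  assumes E: "module R E" and B: "module R B" and u: "u \<in> tensor_kernel R B E"
  shows "\<exists>F. finite F \<and> F \<subseteq> carrier B \<and>
    (\<forall>D. submodule D R B \<longrightarrow> F \<subseteq> D \<longrightarrow> u \<in> tensor_kernel R (B\<lparr>carrier := D\<rparr>) E)"
  using B E u
proof (induction rule: tensor_kernel_induct)
  case zero
  show ?case using tensor_kernel_zero by blast
next
  case (add_left x x' y)
  then show ?case using tensor_kernel_add_left[of x "B\<lparr>carrier := _\<rparr>" x' y E R]
    by (intro exI[of _ "{x, x'}"]) simp
next
  case (add_right x y y')
  then show ?case using tensor_kernel_add_right[of x "B\<lparr>carrier := _\<rparr>" y E y' R]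
    by (intro exI[of _ "{x}"]) simp
next
  case (smult r x y)
  then show ?case using tensor_kernel_smult[of r R x "B\<lparr>carrier := _\<rparr>" y E]
    by (intro exI[of _ "{x}"]) simp
next
  case (add v w)
  then obtain F G where "finite F" "F \<subseteq> carrier B" "finite G" "G \<subseteq> carrier B"
    "\<And>D. submodule D R B \<Longrightarrow> F \<subseteq> D \<Longrightarrow> v \<in> tensor_kernel R (B\<lparr>carrier := D\<rparr>) E"
    "\<And>D. submodule D R B \<Longrightarrow> G \<subseteq> D \<Longrightarrow> w \<in> tensor_kernel R (B\<lparr>carrier := D\<rparr>) E"
    by blast
  then show ?case by (intro exI[of _ "F \<union> G"]) (auto intro: tensor_kernel_add)
next
  case (minus v)
  then show ?case using tensor_kernel_minus[OF module.module_submodule[OF B] E] by metis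
qed

text \<open>An injective map is an isomorphism onto its image followed by an inclusion. The
  inclusion is handled by adjoining finitely many elements one at a time, the isomorphism by
  tensoring with its inverse.\<close>

lemma flat_module_if_torsion_divides:
  fixes R :: "('a, 'b) ring_scheme" and E :: "('a, 'm, 'c) module_scheme"
  assumes E: "module R E"
    and chain: "\<And>x y. x \<in> carrier R \<Longrightarrow> y \<in> carrier R \<Longrightarrow>
      (\<exists>c\<in>carrier R. x = c \<otimes>\<^bsub>R\<^esub> y) \<or> (\<exists>c\<in>carrier R. y = c \<otimes>\<^bsub>R\<^esub> x)"
    and torsion: "\<And>r e. r \<in> carrier R \<Longrightarrow> e \<in> carrier E \<Longrightarrow> r \<odot>\<^bsub>E\<^esub> e = \<zero>\<^bsub>E\<^esub> \<Longrightarrow>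
      \<exists>s\<in>carrier R. \<exists>e'\<in>carrier E. s \<otimes>\<^bsub>R\<^esub> r = \<zero>\<^bsub>R\<^esub> \<and> e = s \<odot>\<^bsub>E\<^esub> e'"
  shows "flat_module TYPE('t) R E"
proof (rule flat_moduleI[OF E])
  fix A B :: "('a, 't) module" and f u
  assume A: "module R A" and B: "module R B" and f: "f \<in> module_hom R A B"
    and inj: "inj_on f (carrier A)" and keys: "Poly_Mapping.keys u \<subseteq> carrier A \<times> carrier E"
    and fu: "frag_extend (\<lambda>(x, y). frag_of (f x, y)) u \<in> tensor_kernel R B E"
  interpret A: module R A by fact
  interpret B: module R B by fact
  note f' = module_homD[OF f]
  let ?C = "f ` carrier A" and ?fu = "frag_extend (\<lambda>(x, y). frag_of (f x, y)) u"
  have C: "submodule ?C R B"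
  proof (rule B.submoduleI)
    show "?C \<subseteq> carrier B" using f' by blast
    show "\<zero>\<^bsub>B\<^esub> \<in> ?C" using module_hom_zero[OF A B f] A.zero_closed by (metis imageI)
    show sm: "r \<odot>\<^bsub>B\<^esub> x \<in> ?C" if "r \<in> carrier R" "x \<in> ?C" for r x
      using that f'(3) by (auto simp flip: f'(3))
    show "\<ominus>\<^bsub>B\<^esub> x \<in> ?C" if "x \<in> ?C" for x
      using sm[of "\<ominus>\<^bsub>R\<^esub> \<one>\<^bsub>R\<^esub>", OF _ that] that f'(1) by (auto simp: B.smult_l_minus)
    show "x \<oplus>\<^bsub>B\<^esub> y \<in> ?C" if "x \<in> ?C" "y \<in> ?C" for x y
      using that by (auto simp flip: f'(2))
  qed
  \<comment> \<open>Induction on \<open>F\<close> with \<open>C\<close> varying: adjoining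
    \<open>b\<close> enlarges \<open>C\<close> and leaves fewer elements to absorb, and
    \<open>tensor_kernel_cyclic_extension\<close> brings \<open>w\<close> back down to
    \<open>C\<close>. Once \<open>F\<close> is empty, the last assumption applies to
    \<open>C\<close> itself.\<close>
  have descend: "w \<in> tensor_kernel R (B\<lparr>carrier := C\<rparr>) E"
    if "finite F" "F \<subseteq> carrier B" "submodule C R B" "Poly_Mapping.keys w \<subseteq> C \<times> carrier E"
      "\<And>D. submodule D R B \<Longrightarrow> F \<union> C \<subseteq> D \<Longrightarrow> w \<in> tensor_kernel R (B\<lparr>carrier := D\<rparr>) E" for F C w
    using that
  proof (induction F arbitrary: C rule: finite_induct)
    case empty
    then show ?case by simp
  next
    case (insert b F)
    define D where "D = {c \<oplus>\<^bsub>B\<^esub> r \<odot>\<^bsub>B\<^esub> b | c r. c \<in> C \<and> r \<in> carrier R}"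
    have b: "b \<in> carrier B" using insert by simp
    have D: "submodule D R B" "C \<subseteq> D" "b \<in> D"
      unfolding D_def by (intro B.submodule_cyclic_extension insert b)+
    have "w \<in> tensor_kernel R (B\<lparr>carrier := X\<rparr>) E" if "submodule X R B" "F \<union> D \<subseteq> X" for X
      by (rule insert.prems(4)[OF that(1)]) (use that(2) D in blast)
    then have "w \<in> tensor_kernel R (B\<lparr>carrier := D\<rparr>) E"
      using insert.IH[OF _ D(1)] insert.prems(1,3) D(2) by blast
    then show ?case
      using tensor_kernel_cyclic_extension[OF E B insert.prems(2) b chain torsion]
        insert.prems(3) unfolding D_def by blast
  qed
  obtain F where F: "finite F" "F \<subseteq> carrier B"
    "\<And>D. submodule D R B \<Longrightarrow> F \<subseteq> D \<Longrightarrow> ?fu \<in> tensor_kernel R (B\<lparr>carrier := D\<rparr>) E"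
    using tensor_kernel_finitely_generated[OF E B fu] by blast
  have "Poly_Mapping.keys ?fu \<subseteq> (\<Union>p\<in>Poly_Mapping.keys u. Poly_Mapping.keys (case p of (x, y) \<Rightarrow> frag_of (f x, y)))"
    by (rule keys_frag_extend)
  also have "\<dots> \<subseteq> ?C \<times> carrier E" using keys by auto
  finally have "?fu \<in> tensor_kernel R (B\<lparr>carrier := ?C\<rparr>) E"
    by (rule descend[OF F(1,2) C]) (intro F(3), simp_all)
  \<comment> \<open>The inverse of \<open>f\<close> on its image is linear and returns the vanishing
    tensor to \<open>A\<close>.\<close>
  moreover have "the_inv_into (carrier A) f \<in> module_hom R (B\<lparr>carrier := ?C\<rparr>) A"
    by (rule module_homI) (auto simp: the_inv_into_f_f[OF inj] simp flip: f'(2,3))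
  ultimately have "frag_extend (\<lambda>(x, y). frag_of (the_inv_into (carrier A) f x, y)) ?fu \<in> tensor_kernel R A E"
    using frag_extend_tensor_kernel[OF B.module_submodule[OF C] A E] by blast
  then show "u \<in> tensor_kernel R A E"
    using frag_extend_inverse[OF keys, of "the_inv_into (carrier A) f" f] the_inv_into_f_f[OF inj]
    by simp
qed

text \<open>By \<open>partner\<close>, each principal ideal \<open>R a\<close> is the annihilator of
  some \<open>b\<close>. If \<open>r e = 0\<close> and \<open>s\<close> is the partner of
  \<open>r\<close>, whatever kills \<open>s\<close> is a multiple of \<open>r\<close> and so kills
  \<open>e\<close>; this is the condition under which injectivity divides \<open>e\<close> by
  \<open>s\<close>.\<close>

lemma IF_ringI:
  assumes R: "cring R"
    and chain: "\<And>x y. x \<in> carrier R \<Longrightarrow> y \<in> carrier R \<Longrightarrow>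
      (\<exists>c\<in>carrier R. x = c \<otimes>\<^bsub>R\<^esub> y) \<or> (\<exists>c\<in>carrier R. y = c \<otimes>\<^bsub>R\<^esub> x)"
    and partner: "\<And>a. a \<in> carrier R \<Longrightarrow> \<exists>b\<in>carrier R. b \<otimes>\<^bsub>R\<^esub> a = \<zero>\<^bsub>R\<^esub> \<and>
      (\<forall>x\<in>carrier R. x \<otimes>\<^bsub>R\<^esub> b = \<zero>\<^bsub>R\<^esub> \<longrightarrow> (\<exists>c\<in>carrier R. x = c \<otimes>\<^bsub>R\<^esub> a))"
  shows "IF_ring TYPE('m) TYPE('t) R"
  unfolding IF_ring_def
proof (intro conjI allI impI, rule R)
  fix E :: "('a, 'm) module"
  assume inj: "injective_module TYPE('a) R E"
  then have E: "module R E" by (simp add: injective_module_def)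
  interpret E: module R E by fact
  show "flat_module TYPE('t) R E"
  proof (rule flat_module_if_torsion_divides[OF E chain])
    fix r e assume r: "r \<in> carrier R" and e: "e \<in> carrier E" and re: "r \<odot>\<^bsub>E\<^esub> e = \<zero>\<^bsub>E\<^esub>"
    obtain s where s: "s \<in> carrier R" "s \<otimes>\<^bsub>R\<^esub> r = \<zero>\<^bsub>R\<^esub>"
      "\<And>x. x \<in> carrier R \<Longrightarrow> x \<otimes>\<^bsub>R\<^esub> s = \<zero>\<^bsub>R\<^esub> \<Longrightarrow> \<exists>c\<in>carrier R. x = c \<otimes>\<^bsub>R\<^esub> r"
      using partner[OF r] by blast
    have "x \<odot>\<^bsub>E\<^esub> e = \<zero>\<^bsub>E\<^esub>" if "x \<in> carrier R" "x \<otimes>\<^bsub>R\<^esub> s = \<zero>\<^bsub>R\<^esub>" for x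
      using s(3)[OF that] r e re by (auto simp: E.smult_assoc1)
    then show "\<exists>s\<in>carrier R. \<exists>e'\<in>carrier E. s \<otimes>\<^bsub>R\<^esub> r = \<zero>\<^bsub>R\<^esub> \<and> e = s \<odot>\<^bsub>E\<^esub> e'"
      using injective_module_divides[OF inj s(1) e] s by blast
  qed
qed

section \<open>Quotients and localizations of valuation rings\<close>

lemma valuation_ring_dvd_total:
  assumes "valuation_ring R" "x \<in> carrier R" "y \<in> carrier R"
  shows "(\<exists>c\<in>carrier R. x = c \<otimes>\<^bsub>R\<^esub> y) \<or> (\<exists>c\<in>carrier R. y = c \<otimes>\<^bsub>R\<^esub> x)"
proof -
  interpret cring R using assms(1) by (simp add: valuation_ring_def)
  have "PIdl\<^bsub>R\<^esub> x \<subseteq> PIdl\<^bsub>R\<^esub> y \<or> PIdl\<^bsub>R\<^esub> y \<subseteq> PIdl\<^bsub>R\<^esub> x"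
    using assms cgenideal_ideal unfolding valuation_ring_def by blast
  then show ?thesis
    using cgenideal_self[OF assms(2)] cgenideal_self[OF assms(3)] by (auto simp: cgenideal_def)
qed

text \<open>The alternative \<open>a = c x\<close> would give
  \<open>b a = c (x b) = 0\<close>.\<close>

lemma valuation_ring_dvd_annihilated:
  assumes R: "valuation_ring R" and carr: "x \<in> carrier R" "a \<in> carrier R" "b \<in> carrier R"
    and "x \<otimes>\<^bsub>R\<^esub> b = \<zero>\<^bsub>R\<^esub>" "b \<otimes>\<^bsub>R\<^esub> a \<noteq> \<zero>\<^bsub>R\<^esub>"
  shows "\<exists>c\<in>carrier R. x = c \<otimes>\<^bsub>R\<^esub> a"
proof -
  interpret cring R using R by (simp add: valuation_ring_def)
  have "a \<noteq> c \<otimes>\<^bsub>R\<^esub> x" if "c \<in> carrier R" for c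
    using that assms m_lcomm[of b c x] m_comm[of b x] by auto
  then show ?thesis using valuation_ring_dvd_total[OF R carr(1,2)] by blast
qed

text \<open>Here \<open>r\<close> is the nonzero element that dies. An \<open>a\<close> outside
  \<open>R r\<close> divides \<open>r\<close> by totality, and the cofactor \<open>b\<close> in
  \<open>r = b a\<close> represents a partner of the class of \<open>a\<close>.\<close>

lemma IF_ring_valuation_ring_Quot:
  fixes R :: "('a, 'b) ring_scheme"
  assumes R: "valuation_ring R" and r: "r \<in> carrier R" "r \<noteq> \<zero>\<^bsub>R\<^esub>"
  shows "IF_ring TYPE('m) TYPE('t) (R Quot (PIdl\<^bsub>R\<^esub> r))"
proof -
  interpret cring R using R by (simp add: valuation_ring_def)
  let ?I = "PIdl\<^bsub>R\<^esub> r"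
  let ?Q = "R Quot ?I"
  interpret I: ideal ?I R by (rule cgenideal_ideal[OF r(1)])
  define \<pi> where "\<pi> = (+>\<^bsub>R\<^esub>) ?I"
  have Q: "cring ?Q" by (rule I.quotient_is_cring[OF is_cring])
  interpret \<pi>: ring_hom_ring R ?Q \<pi> unfolding \<pi>_def by (rule I.rcos_ring_hom_ring)
  have carr: "carrier ?Q = \<pi> ` carrier R"
    by (auto simp: FactRing_def A_RCOSETS_def' \<pi>_def)
  have zero: "\<pi> x = \<zero>\<^bsub>?Q\<^esub> \<longleftrightarrow> (\<exists>c\<in>carrier R. x = c \<otimes>\<^bsub>R\<^esub> r)" if "x \<in> carrier R" for x
  proof -
    have "\<pi> x = ?I \<longleftrightarrow> x \<in> ?I"
      unfolding \<pi>_def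
    proof
      assume "?I +>\<^bsub>R\<^esub> x = ?I"
      then show "x \<in> ?I" using I.a_rcos_self[OF that] by simp
    qed (rule I.a_rcos_const)
    moreover have "\<zero>\<^bsub>?Q\<^esub> = ?I" by (simp add: FactRing_def)
    moreover have "x \<in> ?I \<longleftrightarrow> (\<exists>c\<in>carrier R. x = c \<otimes>\<^bsub>R\<^esub> r)" unfolding cgenideal_def by blast
    ultimately show ?thesis by simp
  qed
  have dvd: "\<exists>C\<in>carrier ?Q. \<pi> x = C \<otimes>\<^bsub>?Q\<^esub> \<pi> y"
    if "\<exists>c\<in>carrier R. x = c \<otimes>\<^bsub>R\<^esub> y" "y \<in> carrier R" for x y
  proof -
    from that(1) obtain c where "c \<in> carrier R" "x = c \<otimes>\<^bsub>R\<^esub> y" by blast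
    then show ?thesis using that(2) by (intro bexI[of _ "\<pi> c"]) simp_all
  qed
  show ?thesis
  proof (rule IF_ringI[OF Q])
    fix X Y assume "X \<in> carrier ?Q" "Y \<in> carrier ?Q"
    then obtain x y where *: "x \<in> carrier R" "X = \<pi> x" "y \<in> carrier R" "Y = \<pi> y"
      unfolding carr by blast
    then show "(\<exists>c\<in>carrier ?Q. X = c \<otimes>\<^bsub>?Q\<^esub> Y) \<or> (\<exists>c\<in>carrier ?Q. Y = c \<otimes>\<^bsub>?Q\<^esub> X)"
      unfolding *(2,4) using valuation_ring_dvd_total[OF R *(1,3)] dvd[of x y] dvd[of y x] *(1,3) by blast
  next
    fix A assume "A \<in> carrier ?Q"
    then obtain a where a: "a \<in> carrier R" "A = \<pi> a" unfolding carr by blast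
    show "\<exists>B\<in>carrier ?Q. B \<otimes>\<^bsub>?Q\<^esub> A = \<zero>\<^bsub>?Q\<^esub> \<and>
      (\<forall>X\<in>carrier ?Q. X \<otimes>\<^bsub>?Q\<^esub> B = \<zero>\<^bsub>?Q\<^esub> \<longrightarrow> (\<exists>C\<in>carrier ?Q. X = C \<otimes>\<^bsub>?Q\<^esub> A))"
    proof (cases "A = \<zero>\<^bsub>?Q\<^esub>")
      case True
      \<comment> \<open>The partner of \<open>0\<close> is \<open>1\<close>, whose annihilator is
        the zero ideal.\<close>
      then show ?thesis
        by (intro bexI[of _ "\<one>\<^bsub>?Q\<^esub>"] conjI ballI impI bexI[of _ "\<zero>\<^bsub>?Q\<^esub>"]) simp_all
    next
      case False
      then obtain b where b: "b \<in> carrier R" "r = b \<otimes>\<^bsub>R\<^esub> a"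
        using valuation_ring_dvd_total[OF R a(1) r(1)] zero a by blast
      have "\<pi> b \<otimes>\<^bsub>?Q\<^esub> A = \<zero>\<^bsub>?Q\<^esub>"
      proof -
        have "\<pi> r = \<zero>\<^bsub>?Q\<^esub>" using zero[OF r(1)] r(1) by (metis l_one one_closed)
        then show ?thesis using a b by simp
      qed
      moreover have "\<exists>C\<in>carrier ?Q. X = C \<otimes>\<^bsub>?Q\<^esub> A"
        if "X \<in> carrier ?Q" "X \<otimes>\<^bsub>?Q\<^esub> \<pi> b = \<zero>\<^bsub>?Q\<^esub>" for X
      proof -
        obtain x where x: "x \<in> carrier R" "X = \<pi> x" using \<open>X \<in> carrier ?Q\<close> unfolding carr by blast
        have "\<pi> (x \<otimes>\<^bsub>R\<^esub> b) = \<zero>\<^bsub>?Q\<^esub>" using that x b by simp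
        then obtain c where c: "c \<in> carrier R" "x \<otimes>\<^bsub>R\<^esub> b = c \<otimes>\<^bsub>R\<^esub> r"
          using zero[of "x \<otimes>\<^bsub>R\<^esub> b"] x b by auto
        \<comment> \<open>In \<open>R\<close> the product \<open>x b\<close> is only a multiple
          \<open>c r = c a b\<close>. Subtracting \<open>c a\<close> from \<open>x\<close> makes it
          vanish, so \<open>x - c a\<close>, and with it \<open>x\<close>, is a multiple of
          \<open>a\<close>.\<close>
        have "(x \<ominus>\<^bsub>R\<^esub> c \<otimes>\<^bsub>R\<^esub> a) \<otimes>\<^bsub>R\<^esub> b = x \<otimes>\<^bsub>R\<^esub> b \<ominus>\<^bsub>R\<^esub> c \<otimes>\<^bsub>R\<^esub> a \<otimes>\<^bsub>R\<^esub> b"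
          using x(1) b(1) c(1) a(1) by (simp add: a_minus_def l_distr l_minus)
        also have "c \<otimes>\<^bsub>R\<^esub> a \<otimes>\<^bsub>R\<^esub> b = c \<otimes>\<^bsub>R\<^esub> r"
          unfolding b(2) using b(1) c(1) a(1) by (simp add: m_ac)
        also have "x \<otimes>\<^bsub>R\<^esub> b \<ominus>\<^bsub>R\<^esub> c \<otimes>\<^bsub>R\<^esub> r = \<zero>\<^bsub>R\<^esub>"
          unfolding c(2) using c(1) r(1) by (simp add: a_minus_def r_neg)
        finally obtain d where d: "d \<in> carrier R" "x \<ominus>\<^bsub>R\<^esub> c \<otimes>\<^bsub>R\<^esub> a = d \<otimes>\<^bsub>R\<^esub> a"
          using valuation_ring_dvd_annihilated[OF R _ a(1) b(1), of "x \<ominus>\<^bsub>R\<^esub> c \<otimes>\<^bsub>R\<^esub> a"] r(2)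
            x(1) a(1) c(1) unfolding b(2) by auto
        have "x = (x \<ominus>\<^bsub>R\<^esub> c \<otimes>\<^bsub>R\<^esub> a) \<oplus>\<^bsub>R\<^esub> c \<otimes>\<^bsub>R\<^esub> a"
          using x(1) c(1) a(1) by (simp add: a_minus_def a_assoc l_neg)
        also have "\<dots> = (d \<oplus>\<^bsub>R\<^esub> c) \<otimes>\<^bsub>R\<^esub> a"
          unfolding d(2) using d(1) c(1) a(1) by (simp add: l_distr)
        finally have "x = (d \<oplus>\<^bsub>R\<^esub> c) \<otimes>\<^bsub>R\<^esub> a" .
        then show ?thesis
          unfolding x(2) a(2) using d(1) c(1) by (intro dvd a(1)) blast
      qed
      ultimately show ?thesis using \<pi>.hom_closed[OF b(1)] by blast
    qed
  qed
qed

text \<open>The nonzero \<open>y\<close> dies in the localization, being killed by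
  \<open>z \<in> S\<close>. As for quotients, a numerator \<open>a\<close> of a nonzero fraction
  divides \<open>y\<close>, and the cofactor gives the partner.\<close>

lemma IF_ring_valuation_ring_localization:
  fixes R :: "('a, 'b) ring_scheme"
  assumes R: "valuation_ring R" and S: "submonoid S R"
    and z: "z \<in> S" "y \<in> carrier R" "y \<noteq> \<zero>\<^bsub>R\<^esub>" "z \<otimes>\<^bsub>R\<^esub> y = \<zero>\<^bsub>R\<^esub>"
  shows "IF_ring TYPE('m) TYPE('t) (localization R S)"
proof -
  have cR: "cring R" using R by (simp add: valuation_ring_def)
  interpret cring R by (rule cR)
  let ?L = "localization R S"
  have L: "cring ?L" by (rule localization_cring[OF cR S])
  interpret L: cring ?L by (rule L)
  note SR = fraction_denom[OF cR S]
  note carr = localization_carrier[OF cR S] and mult = fraction_mult[OF cR S]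
    and eqI = fraction_eqI[OF cR S]
  have LI: "fraction R S a s \<in> carrier ?L" if "a \<in> carrier R" "s \<in> S" for a s
    using that unfolding carr by blast
  have zero: "fraction R S a s = \<zero>\<^bsub>?L\<^esub> \<longleftrightarrow> (\<exists>t\<in>S. t \<otimes>\<^bsub>R\<^esub> a = \<zero>\<^bsub>R\<^esub>)"
    if "a \<in> carrier R" "s \<in> S" for a s
    unfolding localization_zero[OF cR S]
    using fraction_eq_iff[OF cR S that(1) zero_closed that(2) SR(2)] that SR by simp
  \<comment> \<open>Since \<open>w\<close> becomes invertible, divisibility of \<open>w x\<close> is
    enough: from \<open>w x = c a\<close> follows
    \<open>x / t = (c s / (w t)) (a / s)\<close>.\<close>
  have dvd: "\<exists>C\<in>carrier ?L. fraction R S x t = C \<otimes>\<^bsub>?L\<^esub> fraction R S a s"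
    if "a \<in> carrier R" "s \<in> S" "x \<in> carrier R" "t \<in> S" "w \<in> S" "c \<in> carrier R" "w \<otimes>\<^bsub>R\<^esub> x = c \<otimes>\<^bsub>R\<^esub> a"
    for a s x t w c
  proof
    note cl = that(1,3,6) that(2,4,5)[THEN SR(1)]
    have "fraction R S x t = fraction R S (c \<otimes>\<^bsub>R\<^esub> s \<otimes>\<^bsub>R\<^esub> a) (w \<otimes>\<^bsub>R\<^esub> t \<otimes>\<^bsub>R\<^esub> s)"
    proof (rule eqI)
      have "w \<otimes>\<^bsub>R\<^esub> t \<otimes>\<^bsub>R\<^esub> s \<otimes>\<^bsub>R\<^esub> x = t \<otimes>\<^bsub>R\<^esub> s \<otimes>\<^bsub>R\<^esub> (w \<otimes>\<^bsub>R\<^esub> x)" using cl by (simp add: m_ac)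
      also have "\<dots> = t \<otimes>\<^bsub>R\<^esub> (c \<otimes>\<^bsub>R\<^esub> s \<otimes>\<^bsub>R\<^esub> a)" unfolding that(7) using cl by (simp add: m_ac)
      finally show "w \<otimes>\<^bsub>R\<^esub> t \<otimes>\<^bsub>R\<^esub> s \<otimes>\<^bsub>R\<^esub> x = t \<otimes>\<^bsub>R\<^esub> (c \<otimes>\<^bsub>R\<^esub> s \<otimes>\<^bsub>R\<^esub> a)" .
    qed (use that cl SR(3) in auto)
    then show "fraction R S x t = fraction R S (c \<otimes>\<^bsub>R\<^esub> s) (w \<otimes>\<^bsub>R\<^esub> t) \<otimes>\<^bsub>?L\<^esub> fraction R S a s"
      using that cl SR(3) by (simp add: mult)
    show "fraction R S (c \<otimes>\<^bsub>R\<^esub> s) (w \<otimes>\<^bsub>R\<^esub> t) \<in> carrier ?L"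
      using that cl SR(3) by (simp add: LI)
  qed
  show ?thesis
  proof (rule IF_ringI[OF L])
    fix X Y assume "X \<in> carrier ?L" "Y \<in> carrier ?L"
    then obtain a s b t where *: "a \<in> carrier R" "s \<in> S" "X = fraction R S a s"
      "b \<in> carrier R" "t \<in> S" "Y = fraction R S b t"
      unfolding carr by blast
    then show "(\<exists>c\<in>carrier ?L. X = c \<otimes>\<^bsub>?L\<^esub> Y) \<or> (\<exists>c\<in>carrier ?L. Y = c \<otimes>\<^bsub>?L\<^esub> X)"
      using valuation_ring_dvd_total[OF R *(1,4)]
        dvd[OF *(1,2,4,5) SR(2)] dvd[OF *(4,5,1,2) SR(2)]
      unfolding *(3,6) l_one[OF *(1)] l_one[OF *(4)] by blast
  next
    fix A assume "A \<in> carrier ?L"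
    then obtain a s where a: "a \<in> carrier R" "s \<in> S" "A = fraction R S a s" unfolding carr by blast
    show "\<exists>B\<in>carrier ?L. B \<otimes>\<^bsub>?L\<^esub> A = \<zero>\<^bsub>?L\<^esub> \<and>
      (\<forall>X\<in>carrier ?L. X \<otimes>\<^bsub>?L\<^esub> B = \<zero>\<^bsub>?L\<^esub> \<longrightarrow> (\<exists>C\<in>carrier ?L. X = C \<otimes>\<^bsub>?L\<^esub> A))"
    proof (cases "A = \<zero>\<^bsub>?L\<^esub>")
      case True
      then show ?thesis
        by (intro bexI[of _ "\<one>\<^bsub>?L\<^esub>"] conjI ballI impI bexI[of _ "\<zero>\<^bsub>?L\<^esub>"]) simp_all
    next
      case False
      \<comment> \<open>A multiple of \<open>y\<close> is killed by \<open>z\<close>, so a fraction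
        with such a numerator would be zero.\<close>
      have "a \<noteq> c \<otimes>\<^bsub>R\<^esub> y" if "c \<in> carrier R" for c
        using False zero[OF a(1,2)] a(3) z(1) m_lcomm[of z c y] z(2,4) SR(1)[OF z(1)] that by auto
      then obtain b where b: "b \<in> carrier R" "y = b \<otimes>\<^bsub>R\<^esub> a"
        using valuation_ring_dvd_total[OF R a(1) z(2)] by blast
      have "fraction R S b \<one>\<^bsub>R\<^esub> \<otimes>\<^bsub>?L\<^esub> A = \<zero>\<^bsub>?L\<^esub>"
        using a b z SR by (simp add: mult zero) blast
      moreover have "\<exists>C\<in>carrier ?L. X = C \<otimes>\<^bsub>?L\<^esub> A"
        if "X \<in> carrier ?L" "X \<otimes>\<^bsub>?L\<^esub> fraction R S b \<one>\<^bsub>R\<^esub> = \<zero>\<^bsub>?L\<^esub>" for X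
      proof -
        obtain x t where x: "x \<in> carrier R" "t \<in> S" "X = fraction R S x t"
          using \<open>X \<in> carrier ?L\<close> unfolding carr by blast
        have "fraction R S (x \<otimes>\<^bsub>R\<^esub> b) (t \<otimes>\<^bsub>R\<^esub> \<one>\<^bsub>R\<^esub>) = \<zero>\<^bsub>?L\<^esub>" using that x b SR(2) by (simp add: mult)
        \<comment> \<open>A vanishing fraction only means that some \<open>w \<in> S\<close> kills
          \<open>x b\<close>. So it is \<open>w x\<close> that annihilates \<open>b\<close>, and
          \<open>b a = y \<noteq> 0\<close> makes \<open>w x\<close> a multiple of
          \<open>a\<close>.\<close>
        then obtain w where w: "w \<in> S" "w \<otimes>\<^bsub>R\<^esub> (x \<otimes>\<^bsub>R\<^esub> b) = \<zero>\<^bsub>R\<^esub>"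
          using zero[of "x \<otimes>\<^bsub>R\<^esub> b" "t \<otimes>\<^bsub>R\<^esub> \<one>\<^bsub>R\<^esub>"] x b SR by auto
        then obtain c where "c \<in> carrier R" "w \<otimes>\<^bsub>R\<^esub> x = c \<otimes>\<^bsub>R\<^esub> a"
          using valuation_ring_dvd_annihilated[OF R _ a(1) b(1), of "w \<otimes>\<^bsub>R\<^esub> x"] x b SR(1) z(3)
          by (auto simp: m_assoc)
        then show ?thesis using dvd[OF a(1,2) x(1,2) w(1)] a(3) x(3) by blast
      qed
      ultimately show ?thesis using LI[OF b(1) SR(2)] by blast
    qed
  qed
qed

theorem theorem2p4:
  fixes R :: "('a, 'b) ring_scheme" and P Z :: "'a set"
  assumes "valuation_ring R"
    and "maximalideal P R"
    and "Z = zerodivisors R"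
  shows "(\<forall>r \<in> P. r \<noteq> \<zero>\<^bsub>R\<^esub> \<longrightarrow>
            IF_ring TYPE('m) TYPE('t) (R Quot (PIdl\<^bsub>R\<^esub> r))) \<and>
         (\<forall>J. primeideal J R \<longrightarrow> J \<subset> Z \<longrightarrow>
            IF_ring TYPE('m) TYPE('t) (localization_at_prime R J))"
proof (intro conjI ballI allI impI)
  fix r assume "r \<in> P" "r \<noteq> \<zero>\<^bsub>R\<^esub>"
  moreover have "ideal P R" using assms(2) by (rule maximalideal.axioms(1))
  ultimately show "IF_ring TYPE('m) TYPE('t) (R Quot (PIdl\<^bsub>R\<^esub> r))"
    using IF_ring_valuation_ring_Quot[OF assms(1)] ideal.Icarr by metis
next
  fix J assume J: "primeideal J R" "J \<subset> Z"
  \<comment> \<open>Strictness of \<open>J \<subset> Z\<close> puts a zerodivisor \<open>z\<close>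
    among the denominators; a nonzero \<open>y\<close> with \<open>z y = 0\<close> is the element
    that dies in the localization.\<close>
  then obtain z y where "z \<in> carrier R - J" "y \<in> carrier R" "y \<noteq> \<zero>\<^bsub>R\<^esub>" "z \<otimes>\<^bsub>R\<^esub> y = \<zero>\<^bsub>R\<^esub>"
    using assms(3) unfolding zerodivisors_def by blast
  then show "IF_ring TYPE('m) TYPE('t) (localization_at_prime R J)"
    unfolding localization_at_prime_def
    by (rule IF_ring_valuation_ring_localization[OF assms(1) primeideal_compl_submonoid[OF J(1)]])
qed

end
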